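(* Let $k\ge0$ be an integer, regard $n$ as an indeterminate, and let $G_{kn}$ be the Gram matrix associated to $B_n^+$. Then, as an identity of rational functions in $n$, $$\det(G_{kn})=n^{a_k}\prod_{r=1}^{[k/2]}P_r(n-1)^{\sum_{l=1}^{[k/2]}\binom{k}{2l}d_{lr}}.$$
   Context: Let $\mathcal P_b^+(k)$ be the set of noncrossing set partitions of $\{1,\dots,k\}$ with all blocks of size 1 or 2. The Gram matrix associated to $B_n^+$ is $G_{kn}=(n^{|\pi\vee\sigma|})_{\pi,\sigma\in\mathcal P_b^+(k)}$, where $\pi\vee\sigma$ is the join in the lattice of all set partitions of $\{1,\dots,k\}$ and $|\cdot|$ is the number of blocks. Put $a_k=\sum_{\pi\in\mathcal P_b^+(k)}(2|\pi|-k)$. The Chebyshev polynomials $P_r$ are given by $P_0=1$, $P_1=n$, $P_{r+1}=nP_r-P_{r-1}$ (and $P_r(n-1)$ is $P_r$ evaluated at $n-1$). For integers $k,r$, $f_{kr}=\binom{2k}{k-r}-\binom{2k}{k-r-1}$ and $d_{kr}=f_{kr}-f_{k,r+1}$. $[x]$ denotes the integer part, and binomial coefficients with negative lower index are $0$. *)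

theory Defs
  imports
    "HOL-Library.Disjoint_Sets"
    "HOL-Computational_Algebra.Polynomial"
    "HOL-Computational_Algebra.Fraction_Field"
    "Jordan_Normal_Form.Determinant"
begin

definition noncrossing :: "nat set set \<Rightarrow> bool" where
  "noncrossing \<pi> \<longleftrightarrow>
     (\<forall>V\<in>\<pi>. \<forall>W\<in>\<pi>. \<forall>a\<in>V. \<forall>b\<in>W. \<forall>c\<in>V. \<forall>d\<in>W. a < b \<and> b < c \<and> c < d \<longrightarrow> V = W)"

definition nc_partitions12 :: "nat \<Rightarrow> nat set set set" where
  "nc_partitions12 k =
     {\<pi>. partition_on {1..k} \<pi> \<and> noncrossing \<pi> \<and> (\<forall>V\<in>\<pi>. card V = 1 \<or> card V = 2)}"

text \<open>The join in the lattice of all set partitions of \<open>A\<close>, ordered by refinement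
  (finer is smaller).\<close>

definition is_partition_join :: "'a set \<Rightarrow> 'a set set \<Rightarrow> 'a set set \<Rightarrow> 'a set set \<Rightarrow> bool" where
  "is_partition_join A \<pi> \<sigma> \<tau> \<longleftrightarrow>
     refines A \<pi> \<tau> \<and> refines A \<sigma> \<tau> \<and>
     (\<forall>\<rho>. refines A \<pi> \<rho> \<and> refines A \<sigma> \<rho> \<longrightarrow> refines A \<tau> \<rho>)"

definition partition_join :: "'a set \<Rightarrow> 'a set set \<Rightarrow> 'a set set \<Rightarrow> 'a set set" where
  "partition_join A \<pi> \<sigma> = (THE \<tau>. is_partition_join A \<pi> \<sigma> \<tau>)"

lemma is_partition_join_unique:
  "is_partition_join A \<pi> \<sigma> \<tau> \<Longrightarrow> is_partition_join A \<pi> \<sigma> \<tau>' \<Longrightarrow> \<tau> = \<tau>'"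
  unfolding is_partition_join_def by (meson refines_asym)

lemma is_partition_join_partition_join:
  assumes \<pi>: "partition_on A \<pi>" and \<sigma>: "partition_on A \<sigma>"
  shows "is_partition_join A \<pi> \<sigma> (partition_join A \<pi> \<sigma>)"
proof -
  define U where "U = {\<rho>. refines A \<pi> \<rho> \<and> refines A \<sigma> \<rho>}"
  have U: "partition_on A \<rho>" "refines A \<pi> \<rho>" "refines A \<sigma> \<rho>" if "\<rho> \<in> U" for \<rho>
    using that by (auto simp: U_def refines_def)
  have "U \<noteq> {}"
  proof (cases "A = {}")
    case True
    then have "{} \<in> U"
      using \<pi> \<sigma> by (auto simp: U_def refines_def partition_on_empty)
    then show ?thesis by blast
  next
    case False
    then have "{A} \<in> U"
      using \<pi> \<sigma> by (auto simp: U_def refines_def partition_on_space partition_on_def)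
    then show ?thesis by blast
  qed
  then have "refines A \<pi> (common_refinement U)" "refines A \<sigma> (common_refinement U)"
    using common_refinement_coarsest[OF U(1) \<pi> U(2)] common_refinement_coarsest[OF U(1) \<sigma> U(3)]
    by blast+
  moreover have "refines A (common_refinement U) \<rho>" if "\<rho> \<in> U" for \<rho>
    using refines_common_refinement[OF U(1) that] .
  ultimately have *: "is_partition_join A \<pi> \<sigma> (common_refinement U)"
    by (simp add: is_partition_join_def U_def)
  show ?thesis
    unfolding partition_join_def
    by (rule theI[where P = "is_partition_join A \<pi> \<sigma>", OF *]) (rule is_partition_join_unique[OF _ *])
qed

text \<open>The indeterminate \<open>n\<close>, as an element of the field of rational functions over the rationals.\<close>

definition indet :: "rat poly fract" where
  "indet = Fract [:0, 1:] 1"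

text \<open>The list \<open>ps\<close> enumerates the index set of the rows and columns.\<close>

definition gram_matrix :: "nat \<Rightarrow> nat set set list \<Rightarrow> rat poly fract mat" where
  "gram_matrix k ps =
     mat (length ps) (length ps)
       (\<lambda>(i, j). indet ^ card (partition_join {1..k} (ps ! i) (ps ! j)))"

definition gram_exponent :: "nat \<Rightarrow> int" where
  "gram_exponent k = (\<Sum>\<pi>\<in>nc_partitions12 k. 2 * int (card \<pi>) - int k)"

text \<open>This is the normalisation \<open>P\<^sub>r(2 cos t) = sin ((r + 1) t) / sin t\<close>.\<close>

fun chebyshev :: "nat \<Rightarrow> 'a::comm_ring_1 poly" where
  "chebyshev 0 = 1"
| "chebyshev (Suc 0) = [:0, 1:]"
| "chebyshev (Suc (Suc r)) = [:0, 1:] * chebyshev (Suc r) - chebyshev r"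

definition choose_int :: "nat \<Rightarrow> int \<Rightarrow> int" where
  "choose_int m j = (if j < 0 then 0 else int (m choose nat j))"

definition f_coeff :: "nat \<Rightarrow> int \<Rightarrow> int" where
  "f_coeff k r = choose_int (2 * k) (int k - r) - choose_int (2 * k) (int k - r - 1)"

definition d_coeff :: "nat \<Rightarrow> int \<Rightarrow> int" where
  "d_coeff k r = f_coeff k r - f_coeff k (r + 1)"

end

theory Submission
  imports Defs
begin

text \<open>
  The Gram matrix is factored as \<open>X D X\<^sup>T\<close> with \<open>X\<close> unitriangular and \<open>D\<close> diagonal, and the determinant
  is then the product of the diagonal entries of \<open>D\<close>.

  A noncrossing partition with blocks of size at most 2 is encoded by a Motzkin path: singletons
  are flat steps, the left end of an arc is an up step and its right end a down step. This is a
  bijection (\<open>bij_betw_path_of\<close>), so paths can index the columns of \<open>X\<close>. Put \<open>mu h = P\<^sub>h(n - 1)\<close>.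
  The diagonal entry \<open>path_wt\<close> of a path has a factor \<open>n\<close> for each flat step and a factor
  \<open>mu h / mu (h - 1)\<close> for each up step that ends at height \<open>h\<close>. The entry \<open>matching_wt\<close> of \<open>X\<close> at
  a partition \<open>\<pi>\<close> and a path \<open>s\<close> vanishes unless the steps of \<open>s\<close> cancel on every block of \<open>\<pi>\<close>.
  Otherwise each arc of \<open>\<pi>\<close> on which \<open>s\<close> goes up and then down contributes 1, each arc on which
  \<open>s\<close> is flat contributes \<open>1 / n\<close>, and each arc on which \<open>s\<close> goes down and then up to height \<open>h\<close>
  contributes \<open>mu (h - 1) / mu h\<close>.

  The factorisation is \<open>gram_sum_eq_join\<close>. Superimpose \<open>\<pi>\<close> and \<open>\<sigma>\<close>, which gives closed loops and
  chains, and sum over all paths. In the flat state a loop counts 1. Otherwise the path is a height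
  function on the regions of the diagram, and a loop with outer height \<open>h\<close> counts
  \<open>(mu (h + 1) + mu (h - 1)) / mu h = n - 1\<close>, by the Chebyshev recursion. So every loop counts
  \<open>n\<close>, and so does every chain, whose ends are singletons and which is therefore flat. The proof
  contracts a singleton or an innermost arc of \<open>\<sigma>\<close> and follows the effect on \<open>\<pi>\<close>, on the join and
  on the sum.

  \<open>X\<close> is unitriangular because a path that is compatible with \<open>\<pi>\<close> arises from the path of \<open>\<pi>\<close> by
  flattening or reversing arcs, and each such change increases the moment \<open>\<Sum>i. i * s i\<close>
  (\<open>moment_path_of_minimal\<close>).

  It remains to count steps. The flat steps of the path of \<open>\<pi>\<close> are its \<open>2|\<pi>| - k\<close> singletons, which
  gives the power of \<open>n\<close>. The exponent of \<open>mu r\<close> is the number of up steps into height \<open>r\<close>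
  minus the number of those into height \<open>r + 1\<close>, over all closed paths of length \<open>k\<close>. Closed paths
  with a marked up step into height \<open>r\<close> are equinumerous with paths from \<open>0\<close> to \<open>2r\<close>
  (\<open>num_ups_eq\<close>). Choosing the positions of the \<open>2l\<close> steps that are not flat and applying the ballot
  formula to them turns the latter number into \<open>\<Sum>l. (k choose 2l) f\<^sub>l\<^sub>r\<close>.
\<close>

section \<open>Joins of partitions under contraction of a block\<close>

lemma partition_on_block_unique:
  assumes "partition_on A \<rho>" "R \<in> \<rho>" "R' \<in> \<rho>" "x \<in> R" "x \<in> R'"
  shows "R = R'"
  using assms unfolding partition_on_def disjoint_def by blast

lemma partition_on_diff:
  assumes "partition_on A \<rho>"
  shows "partition_on (A - S) ((\<lambda>R. R - S) ` \<rho> - {{}})"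
  unfolding partition_on_def
proof (intro conjI)
  show "\<Union> ((\<lambda>R. R - S) ` \<rho> - {{}}) = A - S"
    using assms by (auto simp: partition_on_def)
  show "disjoint ((\<lambda>R. R - S) ` \<rho> - {{}})"
    using assms by (auto simp: partition_on_def disjoint_def)
qed auto

text \<open>The blocks of \<open>\<pi>\<close> that meet \<open>S\<close> are glued along \<open>S\<close>, and then \<open>S\<close> is cut out. The set
  difference with \<open>{{}}\<close> covers the case that nothing is left.\<close>

lemma partition_on_contract:
  assumes \<pi>: "partition_on A \<pi>" and S: "S \<subseteq> A"
  defines "U \<equiv> \<Union> {V \<in> \<pi>. V \<inter> S \<noteq> {}}"
  shows "partition_on (A - S) ({V \<in> \<pi>. V \<inter> S = {}} \<union> ({U - S} - {{}}))"
  unfolding partition_on_def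
proof (intro conjI)
  have "\<Union> ({V \<in> \<pi>. V \<inter> S = {}} \<union> ({U - S} - {{}})) = \<Union> {V \<in> \<pi>. V \<inter> S = {}} \<union> (U - S)"
    by blast
  also have "\<dots> = \<Union> \<pi> - S" unfolding U_def by blast
  also have "\<dots> = A - S" using \<pi> by (simp add: partition_on_def)
  finally show "\<Union> ({V \<in> \<pi>. V \<inter> S = {}} \<union> ({U - S} - {{}})) = A - S" .
  have "V \<inter> W = {}" if "V \<in> \<pi>" "V \<inter> S = {}" "W \<in> \<pi>" "W \<inter> S \<noteq> {}" for V W
    using partition_on_block_unique[OF \<pi> that(1,3)] that by blast
  then have VU: "V \<inter> (U - S) = {}" if "V \<in> \<pi>" "V \<inter> S = {}" for V
    using that by (auto simp: U_def)
  show "disjoint ({V \<in> \<pi>. V \<inter> S = {}} \<union> ({U - S} - {{}}))"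
    unfolding disjoint_def
  proof (intro ballI impI)
    fix V W assume *: "V \<in> {V \<in> \<pi>. V \<inter> S = {}} \<union> ({U - S} - {{}})"
      "W \<in> {V \<in> \<pi>. V \<inter> S = {}} \<union> ({U - S} - {{}})" "V \<noteq> W"
    show "V \<inter> W = {}"
    proof (cases "V = U - S \<or> W = U - S")
      case True
      with * VU show ?thesis by (auto simp: Int_commute)
    next
      case False
      with * show ?thesis using partition_on_block_unique[OF \<pi>, of V W] by auto
    qed
  qed
  show "{} \<notin> {V \<in> \<pi>. V \<inter> S = {}} \<union> ({U - S} - {{}})"
    using \<pi> by (auto simp: partition_on_def)
qed

text \<open>In the join, \<open>S\<close> lies in a single block together with \<open>U\<close>, so gluing the blocks of \<open>\<pi>\<close> along
  \<open>S\<close> does not change the join. Cutting out \<open>S\<close> then loses a block exactly if \<open>S\<close> was a block of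
  the join, that is, if \<open>U = S\<close>.\<close>

lemma card_partition_join_contract:
  assumes fin: "finite A" and \<pi>: "partition_on A \<pi>" and \<sigma>: "partition_on A \<sigma>" and S: "S \<in> \<sigma>"
  defines "U \<equiv> \<Union> {V \<in> \<pi>. V \<inter> S \<noteq> {}}"
  shows "card (partition_join A \<pi> \<sigma>) =
    card (partition_join (A - S) ({V \<in> \<pi>. V \<inter> S = {}} \<union> ({U - S} - {{}})) (\<sigma> - {S}))
      + (if U = S then 1 else 0)"
proof -
  define \<pi>' where "\<pi>' = {V \<in> \<pi>. V \<inter> S = {}} \<union> ({U - S} - {{}})"
  define \<tau>' where "\<tau>' = partition_join (A - S) \<pi>' (\<sigma> - {S})"
  have S_ne: "S \<noteq> {}" and SA: "S \<subseteq> A" using \<sigma> S by (auto simp: partition_on_def)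
  have SU: "S \<subseteq> U" using \<pi> SA by (auto simp: U_def partition_on_def)
  have p': "partition_on (A - S) \<pi>'"
    unfolding \<pi>'_def U_def using partition_on_contract[OF \<pi> SA] by simp
  have "{V \<in> \<sigma>. V \<inter> S = {}} = \<sigma> - {S}"
    using partition_on_block_unique[OF \<sigma> _ S] S_ne by blast
  moreover have "\<Union> {V \<in> \<sigma>. V \<inter> S \<noteq> {}} = S"
    using partition_on_block_unique[OF \<sigma> _ S] S S_ne by blast
  ultimately have s': "partition_on (A - S) (\<sigma> - {S})"
    using partition_on_contract[OF \<sigma> SA] by simp
  have join: "is_partition_join (A - S) \<pi>' (\<sigma> - {S}) \<tau>'"
    unfolding \<tau>'_def by (rule is_partition_join_partition_join[OF p' s'])
  then have t': "partition_on (A - S) \<tau>'"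
    and \<pi>\<tau>: "\<And>V. V \<in> \<pi>' \<Longrightarrow> \<exists>T\<in>\<tau>'. V \<subseteq> T" and \<sigma>\<tau>: "\<And>V. V \<in> \<sigma> - {S} \<Longrightarrow> \<exists>T\<in>\<tau>'. V \<subseteq> T"
    unfolding is_partition_join_def refines_def by blast+
  have \<tau>'S: "T \<inter> S = {}" "T \<noteq> {}" if "T \<in> \<tau>'" for T
    using t' that by (auto simp: partition_on_def)
  \<comment> \<open>the block that absorbs \<open>S\<close>, or the empty set if \<open>S\<close> is a block of the join by itself\<close>
  have "\<exists>T0. (if U = S then T0 = {} else T0 \<in> \<tau>') \<and> U - S \<subseteq> T0"
    using \<pi>\<tau>[of "U - S"] SU by (cases "U = S") (auto simp: \<pi>'_def)
  then obtain T0 where T0: "if U = S then T0 = {} else T0 \<in> \<tau>'" and UT0: "U - S \<subseteq> T0" by blast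
  define \<tau> where "\<tau> = insert (T0 \<union> S) (\<tau>' - {T0})"
  have T0S: "T0 \<inter> S = {}" using T0 \<tau>'S(1) by (auto split: if_splits)
  have t: "partition_on A \<tau>"
    unfolding partition_on_def
  proof (intro conjI)
    have "\<Union> \<tau>' = A - S" using t' by (auto simp: partition_on_def)
    moreover have "\<Union> \<tau> = \<Union> \<tau>' \<union> S" unfolding \<tau>_def using T0 by (auto split: if_splits)
    ultimately show "\<Union> \<tau> = A" using SA by blast
    have "T \<inter> T0 = {}" if "T \<in> \<tau>' - {T0}" for T
      using that T0 partition_on_block_unique[OF t', of T T0] by (auto split: if_splits)
    then have "T \<inter> (T0 \<union> S) = {}" if "T \<in> \<tau>' - {T0}" for T
      using that \<tau>'S(1)[of T] by auto
    moreover have "T \<inter> T' = {}" if "T \<in> \<tau>' - {T0}" "T' \<in> \<tau>' - {T0}" "T \<noteq> T'" for T T'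
      using that partition_on_block_unique[OF t', of T T'] by auto
    ultimately show "disjoint \<tau>"
      unfolding \<tau>_def disjoint_def by (metis Int_commute insert_iff)
    show "{} \<notin> \<tau>" using S_ne \<tau>'S(2) by (auto simp: \<tau>_def)
  qed
  have \<tau>'\<tau>: "\<exists>T\<in>\<tau>. V \<subseteq> T" if "\<exists>T\<in>\<tau>'. V \<subseteq> T" for V
    using that by (auto simp: \<tau>_def)
  have "is_partition_join A \<pi> \<sigma> \<tau>"
    unfolding is_partition_join_def
  proof (intro conjI allI impI)
    show "refines A \<pi> \<tau>"
      unfolding refines_def
    proof (intro conjI ballI)
      fix V assume V: "V \<in> \<pi>"
      show "\<exists>T\<in>\<tau>. V \<subseteq> T"
      proof (cases "V \<inter> S = {}")
        case True
        then show ?thesis using V \<tau>'\<tau> \<pi>\<tau> by (auto simp: \<pi>'_def)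
      next
        case False
        then have "V \<subseteq> U" using V by (auto simp: U_def)
        then show ?thesis using UT0 by (auto simp: \<tau>_def)
      qed
    qed (use \<pi> t in auto)
    show "refines A \<sigma> \<tau>"
      unfolding refines_def
    proof (intro conjI ballI)
      fix V assume V: "V \<in> \<sigma>"
      show "\<exists>T\<in>\<tau>. V \<subseteq> T"
        using V \<tau>'\<tau> \<sigma>\<tau>[of V] by (cases "V = S") (auto simp: \<tau>_def)
    qed (use \<sigma> t in auto)
    fix \<rho> assume "refines A \<pi> \<rho> \<and> refines A \<sigma> \<rho>"
    then have r: "partition_on A \<rho>" and \<pi>\<rho>: "\<And>V. V \<in> \<pi> \<Longrightarrow> \<exists>R\<in>\<rho>. V \<subseteq> R"
      and \<sigma>\<rho>: "\<And>V. V \<in> \<sigma> \<Longrightarrow> \<exists>R\<in>\<rho>. V \<subseteq> R"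
      unfolding refines_def by blast+
    obtain R0 where R0: "R0 \<in> \<rho>" "S \<subseteq> R0" using \<sigma>\<rho> S by blast
    have UR0: "U \<subseteq> R0"
    proof
      fix x assume "x \<in> U"
      then obtain V where V: "V \<in> \<pi>" "V \<inter> S \<noteq> {}" "x \<in> V" by (auto simp: U_def)
      then obtain R where "R \<in> \<rho>" "V \<subseteq> R" using \<pi>\<rho> by blast
      then show "x \<in> R0" using V R0 partition_on_block_unique[OF r, of R R0] by blast
    qed
    define \<rho>' where "\<rho>' = (\<lambda>R. R - S) ` \<rho> - {{}}"
    have r': "partition_on (A - S) \<rho>'" unfolding \<rho>'_def by (rule partition_on_diff[OF r])
    have in_\<rho>': "\<exists>R\<in>\<rho>'. V \<subseteq> R" if "R \<in> \<rho>" "V \<subseteq> R" "V \<inter> S = {}" "V \<noteq> {}" for V R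
      using that by (auto simp: \<rho>'_def intro!: bexI[of _ "R - S"])
    have "refines (A - S) \<pi>' \<rho>'"
      unfolding refines_def
    proof (intro conjI ballI p' r')
      fix V assume V: "V \<in> \<pi>'"
      then have "V \<inter> S = {}" "V \<noteq> {}" using p' by (auto simp: partition_on_def)
      moreover obtain R where "R \<in> \<rho>" "V \<subseteq> R" using V \<pi>\<rho>[of V] R0 UR0 by (auto simp: \<pi>'_def)
      ultimately show "\<exists>R\<in>\<rho>'. V \<subseteq> R" using in_\<rho>' by simp
    qed
    moreover have "refines (A - S) (\<sigma> - {S}) \<rho>'"
      unfolding refines_def
    proof (intro conjI ballI s' r')
      fix V assume V: "V \<in> \<sigma> - {S}"
      then have "V \<inter> S = {}" "V \<noteq> {}" using s' by (auto simp: partition_on_def)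
      moreover obtain R where "R \<in> \<rho>" "V \<subseteq> R" using V \<sigma>\<rho>[of V] by auto
      ultimately show "\<exists>R\<in>\<rho>'. V \<subseteq> R" using in_\<rho>' by simp
    qed
    ultimately have "refines (A - S) \<tau>' \<rho>'" using join by (auto simp: is_partition_join_def)
    then have \<tau>\<rho>: "\<exists>R\<in>\<rho>. T \<subseteq> R" if T: "T \<in> \<tau>'" for T
    proof -
      obtain R' where "R' \<in> \<rho>'" "T \<subseteq> R'" using \<open>refines (A - S) \<tau>' \<rho>'\<close> T by (auto simp: refines_def)
      then show ?thesis unfolding \<rho>'_def by blast
    qed
    have "T0 \<subseteq> R0"
    proof (cases "U = S")
      case False
      then have "T0 \<in> \<tau>'" using T0 by simp
      then obtain R where "R \<in> \<rho>" "T0 \<subseteq> R" using \<tau>\<rho> by blast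
      moreover have "U - S \<noteq> {}" using False SU by blast
      ultimately show ?thesis using UT0 UR0 R0 partition_on_block_unique[OF r, of R R0] by blast
    qed (use T0 in auto)
    then show "refines A \<tau> \<rho>"
      unfolding refines_def \<tau>_def using t[unfolded \<tau>_def] r \<tau>\<rho> R0 by auto
  qed
  then have "partition_join A \<pi> \<sigma> = \<tau>"
    using is_partition_join_unique is_partition_join_partition_join[OF \<pi> \<sigma>] by blast
  moreover have "card \<tau> = card \<tau>' + (if U = S then 1 else 0)"
  proof -
    have fin\<tau>': "finite \<tau>'" using finite_elements[of "A - S" \<tau>'] fin t' by simp
    have "T0 \<union> S \<notin> \<tau>'" using \<tau>'S(1)[of "T0 \<union> S"] S_ne by auto
    then have "card \<tau> = Suc (card (\<tau>' - {T0}))"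
      using fin\<tau>' by (simp add: \<tau>_def)
    also have "\<dots> = card \<tau>' + (if U = S then 1 else 0)"
    proof (cases "U = S")
      case True
      then have "T0 \<notin> \<tau>'" using T0 \<tau>'S(2)[of T0] by auto
      then show ?thesis using True by simp
    next
      case False
      then have "T0 \<in> \<tau>'" using T0 by simp
      then show ?thesis using card_Suc_Diff1[OF fin\<tau>'] False by simp
    qed
    finally show ?thesis .
  qed
  ultimately show ?thesis unfolding \<tau>'_def \<pi>'_def by simp
qed

lemma partition_join_commute: "partition_join A \<pi> \<sigma> = partition_join A \<sigma> \<pi>"
proof -
  have "is_partition_join A \<pi> \<sigma> = is_partition_join A \<sigma> \<pi>"
    by (auto simp: is_partition_join_def fun_eq_iff)
  then show ?thesis by (simp add: partition_join_def)
qed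

lemma partition_join_empty: "partition_join {} {} {} = {}"
proof -
  have "is_partition_join {} {} {} (partition_join {} {} {})"
    by (rule is_partition_join_partition_join) (auto simp: partition_on_def)
  then show ?thesis by (auto simp: is_partition_join_def refines_def partition_on_empty)
qed

section \<open>Noncrossing partitions with blocks of size at most two\<close>

definition nc_matchings :: "nat set \<Rightarrow> nat set set set" where
  "nc_matchings A = {\<pi>. partition_on A \<pi> \<and> noncrossing \<pi> \<and> (\<forall>V\<in>\<pi>. card V = 1 \<or> card V = 2)}"

text \<open>For disjoint blocks, not crossing means that two points of \<open>W\<close> which enclose one point of \<open>V\<close>
  enclose all of \<open>V\<close>. This form is easier to apply, since it needs no case distinction on the order
  of the four points.\<close>

lemma noncrossing_iff_nested:
  assumes "partition_on A \<pi>"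
  shows "noncrossing \<pi> \<longleftrightarrow>
    (\<forall>V\<in>\<pi>. \<forall>W\<in>\<pi>. \<forall>p\<in>W. \<forall>q\<in>W. \<forall>u\<in>V. \<forall>v\<in>V. V \<noteq> W \<and> p < u \<and> u < q \<longrightarrow> p < v \<and> v < q)"
    (is "_ \<longleftrightarrow> ?nested")
proof
  assume nc: "noncrossing \<pi>"
  show ?nested
  proof (intro ballI impI)
    fix V W p q u v
    assume VW: "V \<in> \<pi>" "W \<in> \<pi>" and pq: "p \<in> W" "q \<in> W" and uv: "u \<in> V" "v \<in> V"
      and *: "V \<noteq> W \<and> p < u \<and> u < q"
    have ne: "v \<noteq> p" "v \<noteq> q"
      using partition_on_block_unique[OF assms VW] uv pq * by auto
    show "p < v \<and> v < q"
    proof (rule ccontr)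
      assume "\<not> (p < v \<and> v < q)"
      then consider "v < p" | "q < v" using ne by linarith
      then show False
      proof cases
        case 1
        have "V = W"
          by (rule nc[unfolded noncrossing_def, rule_format, OF VW uv(2) pq(1) uv(1) pq(2)])
             (use 1 * in auto)
        then show False using * by blast
      next
        case 2
        have "W = V"
          by (rule nc[unfolded noncrossing_def, rule_format, OF VW(2,1) pq(1) uv(1) pq(2) uv(2)])
             (use 2 * in auto)
        then show False using * by blast
      qed
    qed
  qed
next
  assume n: ?nested
  show "noncrossing \<pi>"
    unfolding noncrossing_def
  proof (intro ballI impI)
    fix V W a b c d
    assume mem: "V \<in> \<pi>" "W \<in> \<pi>" "a \<in> V" "b \<in> W" "c \<in> V" "d \<in> W"
      and *: "a < b \<and> b < c \<and> c < d"
    have "d < c" if "V \<noteq> W"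
      using n[rule_format, OF mem(2,1,3,5,4,6)] that * by auto
    then show "V = W" using * by auto
  qed
qed

lemma nc_matchings_partition: "\<pi> \<in> nc_matchings A \<Longrightarrow> partition_on A \<pi>"
  by (simp add: nc_matchings_def)

lemma nc_matchings_nested:
  assumes "\<pi> \<in> nc_matchings A" "V \<in> \<pi>" "W \<in> \<pi>" "p \<in> W" "q \<in> W" "u \<in> V" "v \<in> V" "V \<noteq> W"
    "p < u" "u < q"
  shows "p < v" "v < q"
proof -
  have "noncrossing \<pi>" using assms(1) by (simp add: nc_matchings_def)
  from noncrossing_iff_nested[THEN iffD1, OF nc_matchings_partition[OF assms(1)] this,
      rule_format, OF assms(2-7)] assms(8-10)
  show "p < v" "v < q" by auto
qed

lemma nc_matchings_block_cases:
  assumes "\<pi> \<in> nc_matchings A" "V \<in> \<pi>"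
  obtains a where "V = {a}" "a \<in> A" | a b where "V = {a, b}" "a < b" "a \<in> A" "b \<in> A"
proof -
  have VA: "V \<subseteq> A" using assms by (auto simp: nc_matchings_def partition_on_def)
  consider "card V = 1" | "card V = 2" using assms by (auto simp: nc_matchings_def)
  then show ?thesis
  proof cases
    case 1
    then obtain a where "V = {a}" by (rule card_1_singletonE)
    then show ?thesis using that(1)[of a] VA by simp
  next
    case 2
    then obtain a b where "V = {a, b}" "a \<noteq> b" by (auto simp: card_2_iff)
    then show ?thesis using that(2)[of a b] that(2)[of b a] VA
      by (cases "a < b") (auto simp: insert_commute)
  qed
qed

lemma nc_matchings_block_of:
  assumes "\<pi> \<in> nc_matchings A" "a \<in> A"
  obtains "{a} \<in> \<pi>" | j where "{a, j} \<in> \<pi>" "j \<noteq> a" "j \<in> A"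
proof -
  obtain V where V: "V \<in> \<pi>" "a \<in> V"
    using assms by (auto simp: nc_matchings_def partition_on_def)
  from assms(1) V(1) show ?thesis
  proof (cases rule: nc_matchings_block_cases)
    case (1 c)
    then show ?thesis using V that(1) by simp
  next
    case (2 c d)
    then have "a = c \<or> a = d" using V by auto
    then show ?thesis using V 2 that(2)[of c] that(2)[of d] by (auto simp: insert_commute)
  qed
qed

lemma partition_on_remove_block:
  assumes "partition_on A \<pi>" "S \<in> \<pi>"
  shows "partition_on (A - S) (\<pi> - {S})"
proof -
  have "\<Union> (\<pi> - {S}) = A - S"
    using assms partition_on_block_unique[OF assms(1) _ assms(2)]
    by (auto simp: partition_on_def)
  then show ?thesis using assms by (auto simp: partition_on_def disjoint_def)
qed

lemma nc_matchings_remove_block: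
  assumes "\<pi> \<in> nc_matchings A" "S \<in> \<pi>"
  shows "\<pi> - {S} \<in> nc_matchings (A - S)"
  using assms partition_on_remove_block[of A \<pi> S]
  by (simp add: nc_matchings_def noncrossing_def)

lemma nc_matchings_insert_singleton:
  assumes "\<pi> \<in> nc_matchings A" "a \<notin> A"
  shows "insert {a} \<pi> \<in> nc_matchings (insert a A)"
proof -
  have "partition_on (insert a A) (insert {a} \<pi>)"
    using assms by (auto simp: nc_matchings_def partition_on_def disjoint_def)
  then show ?thesis using assms by (auto simp: nc_matchings_def noncrossing_def)
qed

lemma nc_matchings_insert_arc:
  assumes \<pi>: "\<pi> \<in> nc_matchings A" and ab: "a \<notin> A" "b \<notin> A" "a < b"
    and gap: "A \<inter> {a<..<b} = {}"
  shows "insert {a, b} \<pi> \<in> nc_matchings (insert a (insert b A))"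
proof -
  have adj: "\<not> (a < c \<and> c < b)" if "c \<in> A" for c using gap that by auto
  have UA: "V \<subseteq> A" if "V \<in> \<pi>" for V
    using \<pi> that by (auto simp: nc_matchings_def partition_on_def)
  have p: "partition_on (insert a (insert b A)) (insert {a, b} \<pi>)"
    using assms by (auto simp: nc_matchings_def partition_on_def disjoint_def)
  have "noncrossing (insert {a, b} \<pi>)"
    unfolding noncrossing_iff_nested[OF p]
  proof (intro ballI impI)
    fix V W p q u v
    assume V: "V \<in> insert {a, b} \<pi>" and W: "W \<in> insert {a, b} \<pi>" and pq: "p \<in> W" "q \<in> W"
      and uv: "u \<in> V" "v \<in> V" and *: "V \<noteq> W \<and> p < u \<and> u < q"
    consider "V \<in> \<pi>" "W \<in> \<pi>" | "V = {a, b}" "W \<in> \<pi>" | "W = {a, b}" "V \<in> \<pi>"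
      using V W * by blast
    then show "p < v \<and> v < q"
    proof cases
      case 1
      then show ?thesis using nc_matchings_nested[OF \<pi> 1 pq uv] * by blast
    next
      case 2
      have "p \<in> A" "q \<in> A" using UA[OF 2(2)] pq by auto
      then have "p \<noteq> a" "p \<noteq> b" "q \<noteq> a" "q \<noteq> b"
        using ab by auto
      moreover have "\<not> (a < p \<and> p < b)" "\<not> (a < q \<and> q < b)"
        using adj \<open>p \<in> A\<close> \<open>q \<in> A\<close> by auto
      moreover have "u = a \<or> u = b" "v = a \<or> v = b" using uv 2(1) by auto
      ultimately show ?thesis using * ab(3) by linarith
    next
      case 3
      have "u \<in> A" using UA[OF 3(2)] uv by auto
      then show ?thesis using adj[of u] * 3(1) pq ab(3) by auto
    qed
  qed
  then show ?thesis using p \<pi> ab by (auto simp: nc_matchings_def)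
qed

text \<open>The shortest arc encloses no point: the block of such a point would be a shorter arc.\<close>

lemma adjacent_arc_exists:
  assumes \<pi>: "\<pi> \<in> nc_matchings A" and "finite A" "A \<noteq> {}" and no1: "\<And>a. {a} \<notin> \<pi>"
  obtains a b where "a < b" "{a, b} \<in> \<pi>" "A \<inter> {a<..<b} = {}"
proof -
  define P where "P d \<longleftrightarrow> (\<exists>a b. a < b \<and> {a, b} \<in> \<pi> \<and> b - a = d)" for d :: nat
  obtain c where c: "c \<in> A" using assms by blast
  have "\<exists>d. P d"
    using \<pi> c
  proof (cases rule: nc_matchings_block_of)
    case (2 j)
    then show ?thesis
      unfolding P_def by (cases "c < j") (metis insert_commute linorder_neqE_nat)+
  qed (use no1 in blast)
  then have "P (LEAST d. P d)" by (rule LeastI_ex)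
  then obtain a b where ab: "a < b" "{a, b} \<in> \<pi>" "b - a = (LEAST d. P d)"
    unfolding P_def by blast
  have "\<not> (a < c \<and> c < b)" if "c \<in> A" for c
  proof
    assume c: "a < c \<and> c < b"
    from \<pi> \<open>c \<in> A\<close> show False
    proof (cases rule: nc_matchings_block_of)
      case (2 j)
      have "{c, j} \<noteq> {a, b}" using c by (auto simp: doubleton_eq_iff)
      then have "a < j" "j < b"
        using nc_matchings_nested[OF \<pi> 2(1) ab(2), of a b c j] c by auto
      moreover have "P (max c j - min c j)"
      proof (cases "c < j")
        case True
        then have "max c j - min c j = j - c" by simp
        then show ?thesis unfolding P_def using 2 True by (intro exI[of _ c] exI[of _ j]) simp
      next
        case False
        then have "max c j - min c j = c - j" "j < c" using 2(2) by auto
        then show ?thesis unfolding P_def using 2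
          by (intro exI[of _ j] exI[of _ c]) (simp add: insert_commute)
      qed
      then have "b - a \<le> max c j - min c j" using ab(3) by (simp add: Least_le)
      ultimately show False using c by (auto simp: max_def min_def split: if_splits)
    qed (use no1 in blast)
  qed
  then have "A \<inter> {a<..<b} = {}" by auto
  with ab that show ?thesis by blast
qed

text \<open>Noncrossing forces the cyclic order \<open>a, b, m, j\<close>, and nothing lies between \<open>a\<close> and \<open>b\<close>. The
  three cases tell where the circle is cut open.\<close>

lemma linked_arcs_positions:
  assumes \<pi>: "\<pi> \<in> nc_matchings A" and arcs: "{a, j} \<in> \<pi>" "{b, m} \<in> \<pi>"
    and ne: "a < b" "j \<noteq> a" "j \<noteq> b" "m \<noteq> a" "m \<noteq> b"
    and gap: "A \<inter> {a<..<b} = {}"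
  shows "j < a \<and> b < m \<or> b < m \<and> m < j \<or> m < j \<and> j < a"
proof -
  have adj: "\<not> (a < c \<and> c < b)" if "c \<in> A" for c using gap that by auto
  have jm: "j \<in> A" "m \<in> A" using \<pi> arcs by (auto simp: nc_matchings_def partition_on_def)
  have "j < a \<or> b < j" "m < a \<or> b < m" using adj[OF jm(1)] adj[OF jm(2)] ne by linarith+
  moreover have dne: "{a, j} \<noteq> {b, m}" using ne by (auto simp: doubleton_eq_iff)
  have "j \<noteq> m"
    using partition_on_block_unique[OF nc_matchings_partition[OF \<pi>] arcs, of j] dne by auto
  moreover have "\<not> (m < a \<and> b < j)"
    using nc_matchings_nested[OF \<pi> arcs, of m b a j] dne ne by auto
  moreover have "\<not> (b < j \<and> j < m)"
    using nc_matchings_nested[OF \<pi> arcs, of b m j a] dne ne by auto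
  moreover have "\<not> (j < m \<and> m < a)"
    using nc_matchings_nested[OF \<pi> arcs(2,1), of j a m b] dne ne by auto
  ultimately show ?thesis by linarith
qed

lemma nc_matchings_shorten_arc:
  assumes \<pi>: "\<pi> \<in> nc_matchings A" and arc: "{a, j} \<in> \<pi>" and ne: "j \<noteq> a"
  shows "insert {j} (\<pi> - {{a, j}}) \<in> nc_matchings (A - {a})"
proof -
  have "j \<in> A" using \<pi> arc by (auto simp: nc_matchings_def partition_on_def)
  then have "insert j (A - {a, j}) = A - {a}" using ne by auto
  then show ?thesis
    using nc_matchings_insert_singleton[OF nc_matchings_remove_block[OF \<pi> arc], of j] by simp
qed

text \<open>An arc that separates \<open>j\<close> from \<open>m\<close> also separates \<open>a\<close> from \<open>b\<close>, as it crosses neither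
  \<open>{a, j}\<close> nor \<open>{b, m}\<close>. This is impossible for adjacent \<open>a\<close> and \<open>b\<close>.\<close>

lemma nc_matchings_merge_arcs:
  assumes \<pi>: "\<pi> \<in> nc_matchings A" and arcs: "{a, j} \<in> \<pi>" "{b, m} \<in> \<pi>"
    and ne: "a < b" "j \<noteq> a" "j \<noteq> b" "m \<noteq> a" "m \<noteq> b"
    and gap: "A \<inter> {a<..<b} = {}"
  shows "insert {j, m} (\<pi> - {{a, j}, {b, m}}) \<in> nc_matchings (A - {a, b})"
proof -
  have adj: "\<not> (a < c \<and> c < b)" if "c \<in> A" for c using gap that by auto
  define \<pi>0 where "\<pi>0 = \<pi> - {{a, j}, {b, m}}"
  have part: "partition_on A \<pi>" by (rule nc_matchings_partition[OF \<pi>])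
  have abjm: "a \<in> A" "b \<in> A" "j \<in> A" "m \<in> A"
    using part arcs by (auto simp: partition_on_def)
  have dne: "{a, j} \<noteq> {b, m}" using ne by (auto simp: doubleton_eq_iff)
  then have jm: "j \<noteq> m"
    using partition_on_block_unique[OF part arcs, of j] by auto
  have p0: "partition_on (A - {a, j} - {b, m}) \<pi>0"
    using partition_on_remove_block[OF partition_on_remove_block[OF part arcs(1)], of "{b, m}"]
      arcs(2) dne by (simp add: \<pi>0_def Diff_insert2[symmetric] insert_commute)
  have UA: "V \<subseteq> A - {a, j} - {b, m}" if "V \<in> \<pi>0" for V
    using p0 that by (auto simp: partition_on_def)
  have p: "partition_on (A - {a, b}) (insert {j, m} \<pi>0)"
    using p0 abjm ne unfolding partition_on_def disjoint_def by auto
  have jm_iff: "p < j \<and> j < q \<longleftrightarrow> p < m \<and> m < q" if "W \<in> \<pi>0" "p \<in> W" "q \<in> W" for W p q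
  proof -
    have W: "W \<in> \<pi>" "{a, j} \<noteq> W" "{b, m} \<noteq> W" using that by (auto simp: \<pi>0_def)
    have pq: "p \<in> A" "q \<in> A" "p \<notin> {a, j, b, m}" "q \<notin> {a, j, b, m}" using UA that by blast+
    have "p < a \<and> a < q \<longleftrightarrow> p < j \<and> j < q"
      using nc_matchings_nested[OF \<pi> arcs(1) W(1) that(2,3) _ _ W(2)] by blast
    moreover have "p < b \<and> b < q \<longleftrightarrow> p < m \<and> m < q"
      using nc_matchings_nested[OF \<pi> arcs(2) W(1) that(2,3) _ _ W(3)] by blast
    moreover have "p < a \<and> a < q \<longleftrightarrow> p < b \<and> b < q"
    proof -
      have "p \<noteq> a" "p \<noteq> b" "q \<noteq> a" "q \<noteq> b" using pq by auto
      then show ?thesis using adj[OF pq(1)] adj[OF pq(2)] ne(1) by linarith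
    qed
    ultimately show ?thesis by blast
  qed
  have "noncrossing (insert {j, m} \<pi>0)"
    unfolding noncrossing_iff_nested[OF p]
  proof (intro ballI impI)
    fix V W p q u v
    assume V: "V \<in> insert {j, m} \<pi>0" and W: "W \<in> insert {j, m} \<pi>0" and pq: "p \<in> W" "q \<in> W"
      and uv: "u \<in> V" "v \<in> V" and *: "V \<noteq> W \<and> p < u \<and> u < q"
    consider "V \<in> \<pi>0" "W \<in> \<pi>0" | "V = {j, m}" "W \<in> \<pi>0" | "W = {j, m}" "V \<in> \<pi>0"
      using V W * by blast
    then show "p < v \<and> v < q"
    proof cases
      case 1
      then show ?thesis using nc_matchings_nested[OF \<pi> _ _ pq uv] * by (auto simp: \<pi>0_def)
    next
      case 2
      then show ?thesis using jm_iff[OF 2(2) pq] uv * by auto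
    next
      case 3
      have "v \<noteq> p" "v \<noteq> q" using UA[OF 3(2)] uv pq 3(1) by auto
      moreover have "\<not> v < p" "\<not> q < v"
        using jm_iff[OF 3(2) uv] jm_iff[OF 3(2) uv(2,1)] pq 3(1) * by auto
      ultimately show ?thesis by linarith
    qed
  qed
  then show ?thesis
    using p \<pi> jm by (auto simp: nc_matchings_def \<pi>0_def)
qed

lemma card_join_remove_common_block:
  assumes "finite A" "partition_on A \<pi>" "partition_on A \<sigma>" "S \<in> \<pi>" "S \<in> \<sigma>"
  shows "card (partition_join A \<pi> \<sigma>) = Suc (card (partition_join (A - S) (\<pi> - {S}) (\<sigma> - {S})))"
proof -
  have ne: "S \<noteq> {}" using assms by (auto simp: partition_on_def)
  have "{V \<in> \<pi>. V \<inter> S = {}} = \<pi> - {S}" "\<Union> {V \<in> \<pi>. V \<inter> S \<noteq> {}} = S"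
    using partition_on_block_unique[OF assms(2) _ assms(4)] assms(4) ne by blast+
  then show ?thesis using card_partition_join_contract[OF assms(1,2,3,5)] by simp
qed

lemma card_join_shorten_arc:
  assumes "finite A" and \<pi>: "partition_on A \<pi>" and \<sigma>: "partition_on A \<sigma>" and arc: "{a, j} \<in> \<pi>" and "{a} \<in> \<sigma>" "j \<noteq> a"
  shows "card (partition_join A \<pi> \<sigma>) =
    card (partition_join (A - {a}) (insert {j} (\<pi> - {{a, j}})) (\<sigma> - {{a}}))"
proof -
  have "{V \<in> \<pi>. V \<inter> {a} = {}} = \<pi> - {{a, j}}" "\<Union> {V \<in> \<pi>. V \<inter> {a} \<noteq> {}} = {a, j}"
    using partition_on_block_unique[OF \<pi> _ arc, of _ a] arc by blast+
  moreover have "{a, j} - {a} = {j}" "{a, j} \<noteq> {a}" using \<open>j \<noteq> a\<close> by auto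
  ultimately show ?thesis
    using card_partition_join_contract[OF assms(1) \<pi> \<sigma> \<open>{a} \<in> \<sigma>\<close>] by simp
qed

lemma card_join_merge_arcs:
  assumes "finite A" and \<pi>: "partition_on A \<pi>" and \<sigma>: "partition_on A \<sigma>"
    and arcs: "{a, j} \<in> \<pi>" "{b, m} \<in> \<pi>" and "{a, b} \<in> \<sigma>"
    and ne: "j \<noteq> a" "j \<noteq> b" "m \<noteq> a" "m \<noteq> b"
  shows "card (partition_join A \<pi> \<sigma>) =
    card (partition_join (A - {a, b}) (insert {j, m} (\<pi> - {{a, j}, {b, m}})) (\<sigma> - {{a, b}}))"
proof -
  have "V = {a, j}" if "V \<in> \<pi>" "a \<in> V" for V
    using partition_on_block_unique[OF \<pi> that(1) arcs(1) that(2)] by simp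
  moreover have "V = {b, m}" if "V \<in> \<pi>" "b \<in> V" for V
    using partition_on_block_unique[OF \<pi> that(1) arcs(2) that(2)] by simp
  ultimately have "{V \<in> \<pi>. V \<inter> {a, b} = {}} = \<pi> - {{a, j}, {b, m}}"
    "{V \<in> \<pi>. V \<inter> {a, b} \<noteq> {}} = {{a, j}, {b, m}}"
    using arcs by blast+
  moreover have "\<Union> {{a, j}, {b, m}} - {a, b} = {j, m}" "\<Union> {{a, j}, {b, m}} \<noteq> {a, b}"
    using ne by auto
  ultimately show ?thesis
    using card_partition_join_contract[OF assms(1) \<pi> \<sigma> \<open>{a, b} \<in> \<sigma>\<close>] by (simp del: Union_insert)
qed

section \<open>Motzkin paths and the factorisation of the Gram matrix\<close>

text \<open>Steps are functions on all natural numbers that vanish outside the set of positions. A flat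
  step can then be deleted from the set of positions without changing the function or its heights.\<close>

definition ht :: "(nat \<Rightarrow> int) \<Rightarrow> nat \<Rightarrow> int" where
  "ht s i = sum s {..i}"

definition paths :: "nat set \<Rightarrow> int \<Rightarrow> (nat \<Rightarrow> int) set" where
  "paths A h = {s. (\<forall>i. s i \<in> {-1, 0, 1}) \<and> (\<forall>i. i \<notin> A \<longrightarrow> s i = 0) \<and> (\<forall>i. 0 \<le> ht s i) \<and> sum s A = h}"

lemma pathsD:
  assumes "s \<in> paths A h"
  shows "s i \<in> {-1, 0, 1}" "i \<notin> A \<Longrightarrow> s i = 0" "0 \<le> ht s i" "sum s A = h"
  using assms by (auto simp: paths_def)

lemma sum_fun_upd_int:
  fixes s :: "nat \<Rightarrow> int"
  assumes "finite A"
  shows "sum (s(a := e)) A = sum s A + (if a \<in> A then e - s a else 0)"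
proof -
  have "sum (s(a := e)) A = (\<Sum>i\<in>A. s i + (if i = a then e - s a else 0))"
    by (rule sum.cong) auto
  then show ?thesis using assms by (simp add: sum.distrib)
qed

lemma ht_fun_upd: "ht (s(a := e)) i = ht s i + (if a \<le> i then e - s a else 0)"
  unfolding ht_def using sum_fun_upd_int[of "{..i}" s a e] by simp

lemma ht_add_steps: "i \<le> k \<Longrightarrow> ht s k = ht s i + sum s {i<..k}"
proof -
  assume "i \<le> k"
  then have "{..k} = {..i} \<union> {i<..k}" by auto
  then show ?thesis
    unfolding ht_def using sum.union_disjoint[of "{..i}" "{i<..k}" s] by fastforce
qed

lemma ht_const:
  assumes "i \<le> k" "\<And>j. i < j \<Longrightarrow> j \<le> k \<Longrightarrow> s j = 0"
  shows "ht s i = ht s k"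
  using ht_add_steps[OF assms(1), of s] assms(2) by simp

lemma ht_minus_step_nonneg:
  assumes "\<And>i. 0 \<le> ht s i"
  shows "0 \<le> ht s j - s j"
proof (cases j)
  case (Suc k)
  then show ?thesis using assms[of k] by (simp add: ht_def)
qed (simp add: ht_def)

lemma finite_paths:
  assumes "finite A"
  shows "finite (paths A h)"
proof (rule finite_subset)
  show "paths A h \<subseteq> {s. (\<forall>i\<in>A. s i \<in> {-1, 0, 1}) \<and> (\<forall>i. i \<notin> A \<longrightarrow> s i = 0)}"
    by (auto simp: paths_def)
  show "finite {s. (\<forall>i\<in>A. s i \<in> {-1, 0, 1 :: int}) \<and> (\<forall>i. i \<notin> A \<longrightarrow> s i = 0)}"
    by (rule finite_subset[OF _ finite_set_of_finite_funs[OF assms, of "{-1, 0, 1 :: int}" 0]]) auto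
qed

lemma paths_flat_at:
  assumes "finite A" "a \<in> A"
  shows "{s \<in> paths A h. s a = 0} = paths (A - {a}) h"
proof -
  have "sum s A = sum s (A - {a})" if "s a = 0" for s :: "nat \<Rightarrow> int"
    using assms that by (simp add: sum.remove)
  then show ?thesis using assms by (auto simp: paths_def)
qed

lemma ht_insert_pair:
  assumes "a < b" "t a = 0" "t b = 0"
  shows "ht (t(a := e, b := - e)) i = ht t i + (if a \<le> i \<and> i < b then e else 0)"
  using assms by (simp add: ht_fun_upd)

lemma ht_erase_pair:
  assumes "a < b" "s a + s b = 0"
  shows "ht (s(a := 0, b := 0)) i = ht s i - (if a \<le> i \<and> i < b then s a else 0)"
  using assms by (simp add: ht_fun_upd)

lemma paths_erase_pair:
  assumes fin: "finite A" and ab: "a \<in> A" "b \<in> A" "a < b"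
    and gap: "A \<inter> {a<..<b} = {}"
    and s: "s \<in> paths A h" "s a + s b = 0"
  shows "s(a := 0, b := 0) \<in> paths (A - {a, b}) h"
proof -
  have adj: "\<not> (a < c \<and> c < b)" if "c \<in> A" for c using gap that by auto
  define t where "t = s(a := 0, b := 0)"
  have ht: "ht t i = ht s i - (if a \<le> i \<and> i < b then s a else 0)" for i
    unfolding t_def by (rule ht_erase_pair[OF ab(3) s(2)])
  have t0: "t i = 0" if "i \<notin> A - {a, b}" for i
    using that pathsD(2)[OF s(1)] by (auto simp: t_def)
  have "0 \<le> ht t i" for i
  proof (cases "a \<le> i \<and> i < b")
    case True
    have "ht t i = ht t b"
    proof (rule ht_const)
      fix j assume "i < j" "j \<le> b"
      then show "t j = 0" using True adj[of j] by (intro t0) auto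
    qed (use True in auto)
    then show ?thesis using pathsD(3)[OF s(1), of b] by (simp add: ht)
  next
    case False
    then have "ht t i = ht s i" unfolding ht if_not_P[OF False] by simp
    then show ?thesis using pathsD(3)[OF s(1), of i] by simp
  qed
  moreover have "sum t (A - {a, b}) = sum t A"
    by (rule sum.mono_neutral_left) (use fin t0 in auto)
  moreover have "sum t A = sum s A"
    unfolding t_def sum_fun_upd_int[OF fin] using s(2) ab by simp
  moreover have "t i \<in> {-1, 0, 1}" for i
    using pathsD(1)[OF s(1), of i] by (auto simp: t_def)
  ultimately show ?thesis
    using t0 pathsD(4)[OF s(1)] unfolding t_def[symmetric] paths_def by auto
qed

lemma paths_insert_pair:
  assumes fin: "finite A" and ab: "a \<in> A" "b \<in> A" "a < b"
    and gap: "A \<inter> {a<..<b} = {}"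
    and t: "t \<in> paths (A - {a, b}) h" and e: "e \<in> {-1, 0, 1}" "0 \<le> ht t a + e"
  shows "t(a := e, b := - e) \<in> paths A h"
proof -
  have adj: "\<not> (a < c \<and> c < b)" if "c \<in> A" for c using gap that by auto
  define s where "s = t(a := e, b := - e)"
  have tab: "t a = 0" "t b = 0" using pathsD(2)[OF t] by auto
  have ht: "ht s i = ht t i + (if a \<le> i \<and> i < b then e else 0)" for i
    unfolding s_def by (rule ht_insert_pair[OF ab(3) tab])
  have "0 \<le> ht s i" for i
  proof (cases "a \<le> i \<and> i < b")
    case True
    have "ht t a = ht t i"
    proof (rule ht_const)
      fix j assume "a < j" "j \<le> i"
      then show "t j = 0" using True adj[of j] by (intro pathsD(2)[OF t]) auto
    qed (use True in auto)
    then show ?thesis using e True by (simp add: ht)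
  next
    case False
    then have "ht s i = ht t i" unfolding ht if_not_P[OF False] by simp
    then show ?thesis using pathsD(3)[OF t, of i] by simp
  qed
  moreover have "sum t (A - {a, b}) = sum t A"
    by (rule sum.mono_neutral_left) (use fin tab in auto)
  moreover have "sum s A = sum t A"
    unfolding s_def sum_fun_upd_int[OF fin] using ab tab by simp
  moreover have "s i \<in> {-1, 0, 1}" for i
    using pathsD(1)[OF t, of i] e by (auto simp: s_def)
  moreover have "s i = 0" if "i \<notin> A" for i
    using that ab pathsD(2)[OF t, of i] by (auto simp: s_def)
  ultimately show ?thesis
    using pathsD(4)[OF t] unfolding s_def[symmetric] paths_def by auto
qed

text \<open>Deleting two opposite steps at adjacent positions \<open>a < b\<close> leaves a path, from which the original
  is recovered by the step \<open>e\<close> at \<open>a\<close>. The only constraint on \<open>e\<close> is that the height between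
  the two positions is nonnegative.\<close>

lemma sum_paths_pair:
  fixes F :: "(nat \<Rightarrow> int) \<Rightarrow> 'b::comm_monoid_add"
  assumes fin: "finite A" and ab: "a \<in> A" "b \<in> A" "a < b"
    and gap: "A \<inter> {a<..<b} = {}"
  shows "(\<Sum>s | s \<in> paths A h \<and> s a + s b = 0. F s) =
    (\<Sum>t\<in>paths (A - {a, b}) h. \<Sum>e | e \<in> {-1, 0, 1} \<and> 0 \<le> ht t a + e. F (t(a := e, b := - e)))"
proof -
  let ?E = "\<lambda>t. {e. e \<in> {-1, 0, 1} \<and> 0 \<le> ht t a + e}"
  have "(\<Sum>s | s \<in> paths A h \<and> s a + s b = 0. F s) =
    (\<Sum>(t, e)\<in>Sigma (paths (A - {a, b}) h) ?E. F (t(a := e, b := - e)))"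
  proof (rule sum.reindex_bij_witness)
    fix s assume "s \<in> {s \<in> paths A h. s a + s b = 0}"
    then have s: "s \<in> paths A h" "s a + s b = 0" by auto
    then have sb: "s b = - s a" by simp
    show "(case (s(a := 0, b := 0), s a) of (t, e) \<Rightarrow> t(a := e, b := - e)) = s"
      using sb by (auto simp: fun_eq_iff)
    then show "(case (s(a := 0, b := 0), s a) of (t, e) \<Rightarrow> F (t(a := e, b := - e))) = F s"
      by simp
    show "(s(a := 0, b := 0), s a) \<in> Sigma (paths (A - {a, b}) h) ?E"
      using paths_erase_pair[OF fin ab gap s] pathsD(1)[OF s(1), of a] pathsD(3)[OF s(1), of a] ab
      by (auto simp: ht_erase_pair[OF ab(3) s(2)])
  next
    fix te assume "te \<in> Sigma (paths (A - {a, b}) h) ?E"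
    then obtain t e where te: "te = (t, e)" "t \<in> paths (A - {a, b}) h" "e \<in> {-1, 0, 1}"
      "0 \<le> ht t a + e" by blast
    have tab: "t a = 0" "t b = 0" using pathsD(2)[OF te(2)] by auto
    show "(case te of (t, e) \<Rightarrow> t(a := e, b := - e)) \<in> {s \<in> paths A h. s a + s b = 0}"
      using paths_insert_pair[OF fin ab gap te(2-4)] ab by (simp add: te(1))
    show "((case te of (t, e) \<Rightarrow> t(a := e, b := - e))(a := 0, b := 0),
        (case te of (t, e) \<Rightarrow> t(a := e, b := - e)) a) = te"
      using tab ab by (auto simp: te(1) fun_eq_iff)
  qed
  also have "\<dots> = (\<Sum>t\<in>paths (A - {a, b}) h. \<Sum>e\<in>?E t. F (t(a := e, b := - e)))"
    by (rule sum.Sigma[symmetric])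
       (use fin finite_paths in \<open>auto intro: finite_subset[of _ "{-1, 0, 1}"]\<close>)
  finally show ?thesis .
qed

text \<open>By noncrossingness the points between \<open>p\<close> and \<open>q\<close> form a union of blocks, so their steps
  cancel.\<close>

lemma ht_across_arc:
  assumes \<pi>: "\<pi> \<in> nc_matchings A" and arc: "{p, q} \<in> \<pi>" "p < q"
    and s: "\<And>i. i \<notin> A \<Longrightarrow> s i = 0"
    and inner: "\<And>V. V \<in> \<pi> \<Longrightarrow> V \<subseteq> {p<..<q} \<Longrightarrow> sum s V = 0"
  shows "ht s q = ht s p + s q"
proof -
  define \<pi>0 where "\<pi>0 = {V \<in> \<pi>. V \<subseteq> {p<..<q}}"
  have part: "partition_on A \<pi>" by (rule nc_matchings_partition[OF \<pi>])
  have "sum s {p<..<q} = sum s (\<Union> \<pi>0)"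
  proof (rule sum.mono_neutral_right)
    show "\<forall>i\<in>{p<..<q} - \<Union> \<pi>0. s i = 0"
    proof (intro ballI s notI)
      fix i assume i: "i \<in> {p<..<q} - \<Union> \<pi>0" "i \<in> A"
      then obtain V where V: "V \<in> \<pi>" "i \<in> V" using part by (auto simp: partition_on_def)
      moreover have "V \<noteq> {p, q}" using i V by auto
      ultimately have "v \<in> {p<..<q}" if "v \<in> V" for v
        using nc_matchings_nested[OF \<pi> V(1) arc(1), of p q i v] i that by simp
      then have "V \<subseteq> {p<..<q}" by blast
      then show False using i V by (auto simp: \<pi>0_def)
    qed
  qed (auto simp: \<pi>0_def)
  also have "\<dots> = (\<Sum>V\<in>\<pi>0. sum s V)"
  proof (subst sum.Union_disjoint)
    show "\<forall>V\<in>\<pi>0. finite V" by (auto simp: \<pi>0_def intro: finite_subset)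
    show "\<forall>V\<in>\<pi>0. \<forall>W\<in>\<pi>0. V \<noteq> W \<longrightarrow> V \<inter> W = {}"
      using part by (auto simp: \<pi>0_def partition_on_def disjoint_def)
  qed simp
  also have "\<dots> = 0" using inner by (simp add: \<pi>0_def)
  finally have "sum s {p<..<q} = 0" .
  moreover have "{p<..q} = insert q {p<..<q}" using arc by auto
  ultimately show ?thesis using ht_add_steps[of p q s] arc by simp
qed

text \<open>The facts about \<open>mu h = P\<^sub>h(n - 1)\<close> that the argument uses, extended by \<open>mu (-1) = 0\<close>. With
  this value the recursion holds at \<open>h = 0\<close> as well, where the path cannot step down.\<close>

locale path_weights =
  fixes n :: "'a::field" and mu :: "int \<Rightarrow> 'a"
  assumes n_nonzero: "n \<noteq> 0"
    and mu_neg: "mu (-1) = 0" and mu_0: "mu 0 = 1"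
    and mu_rec: "0 \<le> h \<Longrightarrow> mu (h + 1) + mu (h - 1) = (n - 1) * mu h"
    and mu_nonzero: "0 \<le> h \<Longrightarrow> mu h \<noteq> 0"
begin

definition step_wt :: "(nat \<Rightarrow> int) \<Rightarrow> nat \<Rightarrow> 'a" where
  "step_wt s i = (if s i = 0 then n else if s i = 1 then mu (ht s i) / mu (ht s i - 1) else 1)"

definition path_wt :: "nat set \<Rightarrow> (nat \<Rightarrow> int) \<Rightarrow> 'a" where
  "path_wt A s = (\<Prod>i\<in>A. step_wt s i)"

text \<open>The ratio \<open>mu (h - 1) / mu h\<close> is attached to the right end of a reversed arc, where \<open>s\<close> steps up.\<close>

definition block_wt :: "(nat \<Rightarrow> int) \<Rightarrow> nat set \<Rightarrow> 'a" where
  "block_wt s V =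
    (if sum s V \<noteq> 0 then 0
     else if card V = 1 then 1
     else if s (Max V) = 0 then 1 / n
     else if s (Max V) = 1 then mu (ht s (Max V) - 1) / mu (ht s (Max V))
     else 1)"

definition matching_wt :: "nat set set \<Rightarrow> (nat \<Rightarrow> int) \<Rightarrow> 'a" where
  "matching_wt \<pi> s = (\<Prod>V\<in>\<pi>. block_wt s V)"

definition gram_sum :: "nat set \<Rightarrow> nat set set \<Rightarrow> nat set set \<Rightarrow> 'a" where
  "gram_sum A \<pi> \<sigma> = (\<Sum>s\<in>paths A 0. path_wt A s * matching_wt \<pi> s * matching_wt \<sigma> s)"

lemma gram_sum_commute: "gram_sum A \<pi> \<sigma> = gram_sum A \<sigma> \<pi>"
  unfolding gram_sum_def by (simp add: mult_ac)

lemma block_wt_singleton: "block_wt s {a} = (if s a = 0 then 1 else 0)"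
  by (simp add: block_wt_def)

lemma block_wt_arc:
  assumes "p < q"
  shows "block_wt s {p, q} =
    (if s p + s q \<noteq> 0 then 0 else if s q = 0 then 1 / n
     else if s q = 1 then mu (ht s q - 1) / mu (ht s q) else 1)"
  using assms by (simp add: block_wt_def max_def)

lemma block_wt_arc_unordered:
  assumes "p \<noteq> q" "s p + s q \<noteq> 0"
  shows "block_wt s {p, q} = 0"
  using assms by (simp add: block_wt_def)

lemma block_wt_cong:
  assumes "finite V" "V \<noteq> {}" "\<And>i. i \<in> V \<Longrightarrow> s i = t i" "\<And>i. i \<in> V \<Longrightarrow> ht s i = ht t i"
  shows "block_wt s V = block_wt t V"
proof -
  have "Max V \<in> V" using assms by simp
  moreover have "sum s V = sum t V" using assms by (intro sum.cong) auto
  ultimately show ?thesis using assms(3,4) by (simp add: block_wt_def)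
qed

lemma matching_wt_remove:
  "finite \<pi> \<Longrightarrow> V \<in> \<pi> \<Longrightarrow> matching_wt \<pi> s = block_wt s V * matching_wt (\<pi> - {V}) s"
  unfolding matching_wt_def by (rule prod.remove)

lemma matching_wt_nonzeroD:
  "finite \<pi> \<Longrightarrow> matching_wt \<pi> s \<noteq> 0 \<Longrightarrow> V \<in> \<pi> \<Longrightarrow> sum s V = 0"
  unfolding matching_wt_def block_wt_def by (auto split: if_splits)

lemma finite_matching: "finite A \<Longrightarrow> \<pi> \<in> nc_matchings A \<Longrightarrow> finite \<pi>"
  using finite_elements nc_matchings_partition by blast

text \<open>A singleton of \<open>\<sigma>\<close> forces a flat step of weight \<open>n\<close>.\<close>

lemma gram_sum_flat:
  assumes fin: "finite A" and \<sigma>: "\<sigma> \<in> nc_matchings A" and a: "{a} \<in> \<sigma>"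
  shows "gram_sum A \<pi> \<sigma> =
    (\<Sum>s\<in>paths (A - {a}) 0. n * path_wt (A - {a}) s * matching_wt \<pi> s * matching_wt (\<sigma> - {{a}}) s)"
proof -
  have aA: "a \<in> A" using \<sigma> a by (auto simp: nc_matchings_def partition_on_def)
  have ms: "matching_wt \<sigma> s = (if s a = 0 then matching_wt (\<sigma> - {{a}}) s else 0)" for s
    using matching_wt_remove[OF finite_matching[OF fin \<sigma>] a] by (simp add: block_wt_singleton)
  have "gram_sum A \<pi> \<sigma> =
    (\<Sum>s | s \<in> paths A 0 \<and> s a = 0. path_wt A s * matching_wt \<pi> s * matching_wt \<sigma> s)"
    unfolding gram_sum_def
    by (rule sum.mono_neutral_right) (auto simp: fin finite_paths ms)
  also have "{s. s \<in> paths A 0 \<and> s a = 0} = paths (A - {a}) 0"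
    by (rule paths_flat_at[OF fin aA])
  also have "(\<Sum>s\<in>paths (A - {a}) 0. path_wt A s * matching_wt \<pi> s * matching_wt \<sigma> s) =
    (\<Sum>s\<in>paths (A - {a}) 0. n * path_wt (A - {a}) s * matching_wt \<pi> s * matching_wt (\<sigma> - {{a}}) s)"
  proof (rule sum.cong)
    fix s assume "s \<in> paths (A - {a}) 0"
    then have "s a = 0" using pathsD(2) by auto
    then show "path_wt A s * matching_wt \<pi> s * matching_wt \<sigma> s =
      n * path_wt (A - {a}) s * matching_wt \<pi> s * matching_wt (\<sigma> - {{a}}) s"
      using fin aA by (simp add: ms path_wt_def prod.remove step_wt_def)
  qed simp
  finally show ?thesis .
qed

lemma gram_sum_common_singleton:
  assumes fin: "finite A" and \<pi>: "\<pi> \<in> nc_matchings A" and \<sigma>: "\<sigma> \<in> nc_matchings A"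
    and a: "{a} \<in> \<pi>" "{a} \<in> \<sigma>"
  shows "gram_sum A \<pi> \<sigma> = n * gram_sum (A - {a}) (\<pi> - {{a}}) (\<sigma> - {{a}})"
proof -
  have "matching_wt \<pi> s = matching_wt (\<pi> - {{a}}) s" if "s \<in> paths (A - {a}) 0" for s
    using matching_wt_remove[OF finite_matching[OF fin \<pi>] a(1)] pathsD(2)[OF that, of a]
    by (simp add: block_wt_singleton)
  then show ?thesis
    unfolding gram_sum_flat[OF fin \<sigma> a(2)] unfolding gram_sum_def sum_distrib_left
    by (intro sum.cong) (auto simp: mult_ac)
qed

text \<open>The flat step at \<open>a\<close> forces a flat step at \<open>j\<close>. The factor \<open>n\<close> of the step at \<open>a\<close> cancels
  the factor \<open>1 / n\<close> of the flat arc \<open>{a, j}\<close>.\<close>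

lemma gram_sum_shorten_arc:
  assumes fin: "finite A" and \<pi>: "\<pi> \<in> nc_matchings A" and \<sigma>: "\<sigma> \<in> nc_matchings A"
    and a: "{a, j} \<in> \<pi>" "{a} \<in> \<sigma>" "j \<noteq> a"
  shows "gram_sum A \<pi> \<sigma> = gram_sum (A - {a}) (insert {j} (\<pi> - {{a, j}})) (\<sigma> - {{a}})"
proof -
  have "{j} \<notin> \<pi>"
  proof
    assume "{j} \<in> \<pi>"
    then have "{j} = {a, j}"
      using partition_on_block_unique[OF nc_matchings_partition[OF \<pi>] _ a(1), of "{j}" j] by auto
    then show False using a(3) by auto
  qed
  then have "matching_wt (insert {j} (\<pi> - {{a, j}})) s = n * matching_wt \<pi> s"
    if "s \<in> paths (A - {a}) 0" for s
  proof -
    have "s a = 0" using pathsD(2)[OF that, of a] by simp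
    then have "n * block_wt s {a, j} = block_wt s {j}"
      using n_nonzero a(3) block_wt_arc[of a j s] block_wt_arc[of j a s]
      by (cases "a < j") (auto simp: block_wt_singleton insert_commute)
    moreover have "matching_wt (insert {j} (\<pi> - {{a, j}})) s =
      block_wt s {j} * matching_wt (\<pi> - {{a, j}}) s"
      unfolding matching_wt_def using \<open>{j} \<notin> \<pi>\<close> finite_matching[OF fin \<pi>] by simp
    ultimately show ?thesis
      using matching_wt_remove[OF finite_matching[OF fin \<pi>] a(1), of s] by (simp add: mult_ac)
  qed
  then show ?thesis
    unfolding gram_sum_flat[OF fin \<sigma> a(2)] unfolding gram_sum_def by (intro sum.cong) (auto simp: mult_ac)
qed

text \<open>The weight of the steps \<open>e\<close>, \<open>- e\<close> at adjacent positions, starting at height \<open>x\<close>, times the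
  weight of the arc of \<open>\<sigma>\<close> that joins them. For \<open>e = - 1\<close> the up step and the reversed arc have
  reciprocal weights.\<close>

definition cup_wt :: "int \<Rightarrow> int \<Rightarrow> 'a" where
  "cup_wt x e = (if e = 0 then n else if e = 1 then mu (x + 1) / mu x else 1)"

text \<open>Heights at the other positions do not depend on \<open>e\<close>, so the sum over \<open>e\<close> is local. It only
  involves the weight of \<open>\<pi>\<close>.\<close>

lemma gram_sum_adjacent_arc:
  assumes fin: "finite A" and \<sigma>: "\<sigma> \<in> nc_matchings A" and ab: "{a, b} \<in> \<sigma>" "a < b"
    and gap: "A \<inter> {a<..<b} = {}"
  shows "gram_sum A \<pi> \<sigma> =
    (\<Sum>t\<in>paths (A - {a, b}) 0. path_wt (A - {a, b}) t * matching_wt (\<sigma> - {{a, b}}) t *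
      (\<Sum>e | e \<in> {-1, 0, 1} \<and> 0 \<le> ht t a + e.
        cup_wt (ht t a) e * matching_wt \<pi> (t(a := e, b := - e))))"
proof -
  have adj: "\<not> (a < c \<and> c < b)" if "c \<in> A" for c using gap that by auto
  have abA: "a \<in> A" "b \<in> A" using \<sigma> ab by (auto simp: nc_matchings_def partition_on_def)
  have fs: "finite \<sigma>" by (rule finite_matching[OF fin \<sigma>])
  have "gram_sum A \<pi> \<sigma> =
    (\<Sum>s | s \<in> paths A 0 \<and> s a + s b = 0. path_wt A s * matching_wt \<pi> s * matching_wt \<sigma> s)"
    unfolding gram_sum_def
  proof (rule sum.mono_neutral_right)
    show "\<forall>s\<in>paths A 0 - {s. s \<in> paths A 0 \<and> s a + s b = 0}.
        path_wt A s * matching_wt \<pi> s * matching_wt \<sigma> s = 0"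
    proof
      fix s assume "s \<in> paths A 0 - {s. s \<in> paths A 0 \<and> s a + s b = 0}"
      then have "sum s {a, b} \<noteq> 0" using ab(2) by auto
      then have "matching_wt \<sigma> s = 0" using matching_wt_nonzeroD[OF fs _ ab(1)] by blast
      then show "path_wt A s * matching_wt \<pi> s * matching_wt \<sigma> s = 0" by simp
    qed
  qed (auto simp: fin finite_paths)
  also have "\<dots> = (\<Sum>t\<in>paths (A - {a, b}) 0. \<Sum>e | e \<in> {-1, 0, 1} \<and> 0 \<le> ht t a + e.
      path_wt A (t(a := e, b := - e)) * matching_wt \<pi> (t(a := e, b := - e)) *
      matching_wt \<sigma> (t(a := e, b := - e)))"
    by (rule sum_paths_pair[OF fin abA ab(2) gap])
  also have "\<dots> = (\<Sum>t\<in>paths (A - {a, b}) 0. path_wt (A - {a, b}) t * matching_wt (\<sigma> - {{a, b}}) t *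
      (\<Sum>e | e \<in> {-1, 0, 1} \<and> 0 \<le> ht t a + e.
        cup_wt (ht t a) e * matching_wt \<pi> (t(a := e, b := - e))))"
    unfolding sum_distrib_left
  proof (intro sum.cong refl)
    fix t e assume t: "t \<in> paths (A - {a, b}) 0" and "e \<in> {e. e \<in> {-1, 0, 1} \<and> 0 \<le> ht t a + e}"
    then have e: "e \<in> {-1, 0, 1}" "0 \<le> ht t a + e" by auto
    define s where "s = t(a := e, b := - e)"
    have tab: "t a = 0" "t b = 0" using pathsD(2)[OF t] by auto
    have ht: "ht s i = ht t i + (if a \<le> i \<and> i < b then e else 0)" for i
      unfolding s_def by (rule ht_insert_pair[OF ab(2) tab])
    have "ht t a = ht t b"
    proof (rule ht_const)
      fix j assume "a < j" "j \<le> b"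
      then show "t j = 0" using adj[of j] by (intro pathsD(2)[OF t]) auto
    qed (use ab in auto)
    then have hts: "ht s a = ht t a + e" "ht s b = ht t a" using ht ab by auto
    have sab: "s a = e" "s b = - e" using ab by (auto simp: s_def)
    have same: "s i = t i" "ht s i = ht t i" if i: "i \<in> A - {a, b}" for i
    proof -
      have ne: "i \<noteq> a" "i \<noteq> b" "\<not> (a < i \<and> i < b)" using i adj by auto
      then have outside: "\<not> (a \<le> i \<and> i < b)" by linarith
      show "s i = t i" using ne by (simp add: s_def)
      show "ht s i = ht t i" unfolding ht if_not_P[OF outside] by simp
    qed
    have "path_wt A s = step_wt s a * step_wt s b * path_wt (A - {a, b}) s"
      using prod.remove[of A a "step_wt s"] prod.remove[of "A - {a}" b "step_wt s"] fin abA ab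
      by (simp add: path_wt_def Diff_insert2[symmetric] insert_commute)
    also have "path_wt (A - {a, b}) s = path_wt (A - {a, b}) t"
      unfolding path_wt_def by (intro prod.cong) (auto simp: step_wt_def same)
    finally have 1: "path_wt A s = step_wt s a * step_wt s b * path_wt (A - {a, b}) t" .
    have "matching_wt \<sigma> s = block_wt s {a, b} * matching_wt (\<sigma> - {{a, b}}) s"
      by (rule matching_wt_remove[OF fs ab(1)])
    also have "matching_wt (\<sigma> - {{a, b}}) s = matching_wt (\<sigma> - {{a, b}}) t"
      unfolding matching_wt_def
    proof (rule prod.cong)
      fix V assume V: "V \<in> \<sigma> - {{a, b}}"
      have "partition_on (A - {a, b}) (\<sigma> - {{a, b}})"
        by (rule partition_on_remove_block[OF nc_matchings_partition[OF \<sigma>] ab(1)])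
      then have "V \<subseteq> A - {a, b}" "V \<noteq> {}" using V by (auto simp: partition_on_def)
      then show "block_wt s V = block_wt t V"
        using fin same by (intro block_wt_cong) (auto intro: finite_subset)
    qed simp
    finally have 2: "matching_wt \<sigma> s = block_wt s {a, b} * matching_wt (\<sigma> - {{a, b}}) t" .
    have "0 \<le> ht t a" using pathsD(3)[OF t] .
    then have nz: "mu (ht t a) \<noteq> 0" "mu (ht t a + e) \<noteq> 0" using mu_nonzero e by auto
    have 3: "step_wt s a * step_wt s b * block_wt s {a, b} = cup_wt (ht t a) e"
      using e(1) nz n_nonzero by (auto simp: block_wt_arc[OF ab(2)] step_wt_def cup_wt_def sab hts)
    show "path_wt A (t(a := e, b := - e)) * matching_wt \<pi> (t(a := e, b := - e)) *
        matching_wt \<sigma> (t(a := e, b := - e)) =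
      path_wt (A - {a, b}) t * matching_wt (\<sigma> - {{a, b}}) t *
        (cup_wt (ht t a) e * matching_wt \<pi> (t(a := e, b := - e)))"
      unfolding s_def[symmetric] 1 2 3[symmetric] by (simp add: mult_ac)
  qed
  finally show ?thesis .
qed

lemma matching_wt_insert_pair:
  assumes fin: "finite A" and t: "t \<in> paths (A - {a, b}) h" and "a < b"
    and gap: "A \<inter> {a<..<b} = {}"
    and \<rho>: "\<And>V. V \<in> \<rho> \<Longrightarrow> V \<subseteq> A - {a, b} \<and> V \<noteq> {}"
  shows "matching_wt \<rho> (t(a := e, b := - e)) = matching_wt \<rho> t"
  unfolding matching_wt_def
proof (rule prod.cong)
  have adj: "\<not> (a < c \<and> c < b)" if "c \<in> A" for c using gap that by auto
  fix V assume V: "V \<in> \<rho>"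
  have tab: "t a = 0" "t b = 0" using pathsD(2)[OF t] by auto
  have "ht (t(a := e, b := - e)) i = ht t i" if i: "i \<in> A - {a, b}" for i
  proof -
    have "i \<noteq> a" "\<not> (a < i \<and> i < b)" using i adj by auto
    then have outside: "\<not> (a \<le> i \<and> i < b)" by linarith
    show ?thesis unfolding ht_insert_pair[OF \<open>a < b\<close> tab] if_not_P[OF outside] by simp
  qed
  then show "block_wt (t(a := e, b := - e)) V = block_wt t V"
    using fin \<rho>[OF V] by (intro block_wt_cong) (auto intro: finite_subset)
qed simp


text \<open>The value of a loop. The flat state counts 1, and the other two states together count
  \<open>n - 1\<close> by the recursion of \<open>mu\<close>.\<close>

lemma cup_wt_sum:
  assumes "0 \<le> x"
  shows "(\<Sum>e | e \<in> {-1, 0, 1} \<and> 0 \<le> x + e.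
    cup_wt x e * (if e = 0 then 1 / n else if e = 1 then 1 else mu (x - 1) / mu x)) = n"
proof -
  have "(\<Sum>e | e \<in> {-1, 0, 1} \<and> 0 \<le> x + e.
      cup_wt x e * (if e = 0 then 1 / n else if e = 1 then 1 else mu (x - 1) / mu x)) =
    (\<Sum>e\<in>{-1, 0, 1}. cup_wt x e * (if e = 0 then 1 / n else if e = 1 then 1 else mu (x - 1) / mu x))"
  proof (rule sum.mono_neutral_left)
    show "\<forall>e\<in>{-1, 0, 1} - {e. e \<in> {-1, 0, 1} \<and> 0 \<le> x + e}.
        cup_wt x e * (if e = 0 then 1 / n else if e = 1 then 1 else mu (x - 1) / mu x) = 0"
    proof
      fix e :: int assume "e \<in> {-1, 0, 1} - {e. e \<in> {-1, 0, 1} \<and> 0 \<le> x + e}"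
      then have "x = 0" "e = -1" using assms by auto
      then show "cup_wt x e * (if e = 0 then 1 / n else if e = 1 then 1 else mu (x - 1) / mu x) = 0"
        using mu_neg by simp
    qed
  qed auto
  also have "\<dots> = mu (x - 1) / mu x + (1 + mu (x + 1) / mu x)"
    using n_nonzero by (simp add: cup_wt_def)
  also have "\<dots> = 1 + (mu (x + 1) + mu (x - 1)) / mu x"
    by (simp add: add_divide_distrib)
  also have "\<dots> = n" using mu_rec[OF assms] mu_nonzero[OF assms] by simp
  finally show ?thesis .
qed

lemma gram_sum_common_arc:
  assumes fin: "finite A" and \<pi>: "\<pi> \<in> nc_matchings A" and \<sigma>: "\<sigma> \<in> nc_matchings A"
    and ab: "{a, b} \<in> \<pi>" "{a, b} \<in> \<sigma>" "a < b"
    and gap: "A \<inter> {a<..<b} = {}"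
  shows "gram_sum A \<pi> \<sigma> = n * gram_sum (A - {a, b}) (\<pi> - {{a, b}}) (\<sigma> - {{a, b}})"
proof -
  have adj: "\<not> (a < c \<and> c < b)" if "c \<in> A" for c using gap that by auto
  have part: "partition_on (A - {a, b}) (\<pi> - {{a, b}})"
    by (rule partition_on_remove_block[OF nc_matchings_partition[OF \<pi>] ab(1)])
  have "(\<Sum>e | e \<in> {-1, 0, 1} \<and> 0 \<le> ht t a + e.
      cup_wt (ht t a) e * matching_wt \<pi> (t(a := e, b := - e))) = n * matching_wt (\<pi> - {{a, b}}) t"
    if t: "t \<in> paths (A - {a, b}) 0" for t
  proof -
    have tab: "t a = 0" "t b = 0" using pathsD(2)[OF t] by auto
    have x: "ht t a = ht t b"
    proof (rule ht_const)
      fix j assume "a < j" "j \<le> b"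
      then show "t j = 0" using adj[of j] by (intro pathsD(2)[OF t]) auto
    qed (use ab in auto)
    have "matching_wt \<pi> (t(a := e, b := - e)) =
      (if e = 0 then 1 / n else if e = 1 then 1 else mu (ht t a - 1) / mu (ht t a)) *
        matching_wt (\<pi> - {{a, b}}) t"
      if e: "e \<in> {-1, 0, 1}" for e
    proof -
      have "ht (t(a := e, b := - e)) b = ht t b"
        using ht_insert_pair[OF ab(3) tab, of e b] by simp
      then have "block_wt (t(a := e, b := - e)) {a, b} =
          (if e = 0 then 1 / n else if e = 1 then 1 else mu (ht t a - 1) / mu (ht t a))"
        unfolding block_wt_arc[OF ab(3)] using e ab(3) x by auto
      moreover have "matching_wt (\<pi> - {{a, b}}) (t(a := e, b := - e)) = matching_wt (\<pi> - {{a, b}}) t"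
        by (rule matching_wt_insert_pair[OF fin t ab(3) gap])
           (use part in \<open>auto simp: partition_on_def\<close>)
      ultimately show ?thesis
        by (simp only: matching_wt_remove[OF finite_matching[OF fin \<pi>] ab(1)])
    qed
    then have "(\<Sum>e | e \<in> {-1, 0, 1} \<and> 0 \<le> ht t a + e.
        cup_wt (ht t a) e * matching_wt \<pi> (t(a := e, b := - e))) =
      (\<Sum>e | e \<in> {-1, 0, 1} \<and> 0 \<le> ht t a + e. cup_wt (ht t a) e *
        (if e = 0 then 1 / n else if e = 1 then 1 else mu (ht t a - 1) / mu (ht t a))) *
        matching_wt (\<pi> - {{a, b}}) t"
      unfolding sum_distrib_right by (intro sum.cong refl) (simp only: mem_Collect_eq mult.assoc)
    also have "\<dots> = n * matching_wt (\<pi> - {{a, b}}) t"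
      using cup_wt_sum[OF pathsD(3)[OF t]] by simp
    finally show ?thesis .
  qed
  then show ?thesis
    unfolding gram_sum_adjacent_arc[OF fin \<sigma> ab(2,3) gap] unfolding gram_sum_def sum_distrib_left[of n]
    by (intro sum.cong) (auto simp: mult_ac)
qed

text \<open>The step at \<open>a\<close> must be opposite to that at \<open>j\<close>, so a single \<open>e\<close> survives. For \<open>e = 0\<close> the
  weights are powers of \<open>n\<close>. Otherwise the steps at \<open>a\<close> and \<open>b\<close> straighten out a bend, and the
  claim is that the ratios of \<open>mu\<close> cancel. This holds since the heights at the ends of an arc are
  related by \<open>ht_across_arc\<close>, separately for each relative position of the two arcs.\<close>

lemma merged_arc_weight:
  assumes \<pi>: "\<pi> \<in> nc_matchings A" and arcs: "{a, j} \<in> \<pi>" "{b, m} \<in> \<pi>"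
    and ne: "a < b" "j \<noteq> a" "j \<noteq> b" "m \<noteq> a" "m \<noteq> b"
    and gap: "A \<inter> {a<..<b} = {}"
    and t: "t \<in> paths (A - {a, b}) 0"
    and compat: "\<And>V. V \<in> \<pi> - {{a, j}, {b, m}} \<Longrightarrow> sum t V = 0" and jm: "t j + t m = 0"
  defines "s \<equiv> t(a := - t j, b := t j)"
  shows "0 \<le> ht t a - t j"
    and "cup_wt (ht t a) (- t j) * (block_wt s {a, j} * block_wt s {b, m}) = block_wt t {j, m}"
proof -
  have adj: "\<not> (a < c \<and> c < b)" if "c \<in> A" for c using gap that by auto
  have tab: "t a = 0" "t b = 0" using pathsD(2)[OF t] by auto
  have tA: "t i = 0" if "i \<notin> A" for i using pathsD(2)[OF t] that by auto
  have tm: "t m = - t j" using jm by simp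
  have tj: "t j \<in> {-1, 0, 1}" by (rule pathsD(1)[OF t])
  have htab: "ht t a = ht t b"
  proof (rule ht_const)
    fix j assume "a < j" "j \<le> b"
    then show "t j = 0" using adj[of j] by (intro pathsD(2)[OF t]) auto
  qed (use ne in auto)
  have hts: "ht s i = ht t i + (if a \<le> i \<and> i < b then - t j else 0)" for i
    using ht_insert_pair[OF ne(1) tab, of "- t j" i] by (simp add: s_def)
  have ss: "s a = - t j" "s b = t j" "s j = t j" "s m = - t j"
    using ne tm by (auto simp: s_def)
  have nonneg: "0 \<le> ht t i" for i by (rule pathsD(3)[OF t])
  have pos: "j < a \<and> b < m \<or> b < m \<and> m < j \<or> m < j \<and> j < a"
    by (rule linked_arcs_positions[OF \<pi> arcs ne gap])
  have out_j: "ht t a = ht t j" if "j < a"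
  proof -
    have "{j, a} \<in> \<pi>" using arcs(1) by (simp add: insert_commute)
    then have "ht t a = ht t j + t a"
    proof (rule ht_across_arc[OF \<pi> _ that tA])
      fix V assume V: "V \<in> \<pi>" "V \<subseteq> {j<..<a}"
      then have "V \<noteq> {a, j}" "V \<noteq> {b, m}" using ne by auto
      then show "sum t V = 0" using compat V by simp
    qed
    then show ?thesis using tab by simp
  qed
  have out_m: "ht t m = ht t a - t j" if "b < m" "m < j"
  proof -
    have "ht t m = ht t b + t m"
    proof (rule ht_across_arc[OF \<pi> arcs(2) that(1) tA])
      fix V assume V: "V \<in> \<pi>" "V \<subseteq> {b<..<m}"
      then have "V \<noteq> {a, j}" "V \<noteq> {b, m}" using ne that by auto
      then show "sum t V = 0" using compat V by simp
    qed
    then show ?thesis using htab tm by simp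
  qed
  show x: "0 \<le> ht t a - t j"
  proof (cases "j < a")
    case True
    then show ?thesis using out_j ht_minus_step_nonneg[of t j, OF nonneg] by simp
  next
    case False
    then show ?thesis using out_m nonneg[of m] pos by auto
  qed
  have nz: "mu (ht t a) \<noteq> 0" "mu (ht t a - t j) \<noteq> 0"
    using mu_nonzero nonneg x by blast+
  show "cup_wt (ht t a) (- t j) * (block_wt s {a, j} * block_wt s {b, m}) = block_wt t {j, m}"
    using pos
  proof (elim disjE conjE)
    assume p: "j < a" "b < m"
    have "block_wt s {a, j} = block_wt s {j, a}" by (simp add: insert_commute)
    then show ?thesis
      using tj nz p ne n_nonzero
      by (auto simp: block_wt_arc cup_wt_def ss hts tm)
  next
    assume p: "b < m" "m < j"
    have "block_wt t {j, m} = block_wt t {m, j}" by (simp add: insert_commute)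
    then show ?thesis
      using tj nz p ne n_nonzero out_m[OF p]
      by (auto simp: block_wt_arc cup_wt_def ss hts tm)
  next
    assume p: "m < j" "j < a"
    have "block_wt t {j, m} = block_wt t {m, j}" "block_wt s {a, j} = block_wt s {j, a}"
      "block_wt s {b, m} = block_wt s {m, b}"
      by (simp_all add: insert_commute)
    then show ?thesis
      using tj nz p ne n_nonzero out_j[OF p(2)]
      by (auto simp: block_wt_arc cup_wt_def ss hts tm htab)
  qed
qed

lemma gram_sum_merge_arcs:
  assumes fin: "finite A" and \<pi>: "\<pi> \<in> nc_matchings A" and \<sigma>: "\<sigma> \<in> nc_matchings A"
    and arcs: "{a, j} \<in> \<pi>" "{b, m} \<in> \<pi>" and ab: "{a, b} \<in> \<sigma>"
    and ne: "a < b" "j \<noteq> a" "j \<noteq> b" "m \<noteq> a" "m \<noteq> b"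
    and gap: "A \<inter> {a<..<b} = {}"
  shows "gram_sum A \<pi> \<sigma> =
    gram_sum (A - {a, b}) (insert {j, m} (\<pi> - {{a, j}, {b, m}})) (\<sigma> - {{a, b}})"
proof -
  define \<pi>0 where "\<pi>0 = \<pi> - {{a, j}, {b, m}}"
  have part: "partition_on A \<pi>" by (rule nc_matchings_partition[OF \<pi>])
  have dne: "{a, j} \<noteq> {b, m}" using ne by (auto simp: doubleton_eq_iff)
  then have "j \<noteq> m" using partition_on_block_unique[OF part arcs, of j] by auto
  have fin\<pi>: "finite \<pi>" by (rule finite_matching[OF fin \<pi>])
  have \<pi>0: "V \<subseteq> A - {a, b} \<and> V \<noteq> {}" if "V \<in> \<pi>0" for V
  proof -
    have V: "V \<in> \<pi>" "V \<noteq> {a, j}" "V \<noteq> {b, m}" using that by (auto simp: \<pi>0_def)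
    have "a \<notin> V" using partition_on_block_unique[OF part V(1) arcs(1), of a] V(2) by auto
    moreover have "b \<notin> V" using partition_on_block_unique[OF part V(1) arcs(2), of b] V(3) by auto
    moreover have "V \<subseteq> A" "V \<noteq> {}" using V(1) part by (auto simp: partition_on_def)
    ultimately show ?thesis by auto
  qed
  have "{j, m} \<notin> \<pi>0"
    using partition_on_block_unique[OF part _ arcs(1), of "{j, m}" j] ne
    by (auto simp: \<pi>0_def)
  have split: "matching_wt \<pi> s = block_wt s {a, j} * block_wt s {b, m} * matching_wt \<pi>0 s" for s
  proof -
    have "\<pi> - {{a, j}} - {{b, m}} = \<pi>0" by (auto simp: \<pi>0_def)
    then show ?thesis
      using matching_wt_remove[OF fin\<pi> arcs(1), of s]
        matching_wt_remove[of "\<pi> - {{a, j}}" "{b, m}" s] fin\<pi> arcs(2) dne by (simp add: mult_ac)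
  qed
  have "(\<Sum>e | e \<in> {-1, 0, 1} \<and> 0 \<le> ht t a + e.
      cup_wt (ht t a) e * matching_wt \<pi> (t(a := e, b := - e))) = matching_wt (insert {j, m} \<pi>0) t"
    (is "?L = _") if t: "t \<in> paths (A - {a, b}) 0" for t
  proof -
    let ?E = "{e. e \<in> {-1, 0, 1} \<and> 0 \<le> ht t a + e}"
    let ?s = "\<lambda>e. t(a := e, b := - e)"
    have \<pi>': "matching_wt (insert {j, m} \<pi>0) t = block_wt t {j, m} * matching_wt \<pi>0 t"
      unfolding matching_wt_def using \<open>{j, m} \<notin> \<pi>0\<close> fin\<pi> by (simp add: \<pi>0_def)
    have away: "matching_wt \<pi>0 (?s e) = matching_wt \<pi>0 t" for e
      by (rule matching_wt_insert_pair[OF fin t ne(1) gap \<pi>0])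
    have "?L = (\<Sum>e\<in>?E. cup_wt (ht t a) e * (block_wt (?s e) {a, j} * block_wt (?s e) {b, m})) *
        matching_wt \<pi>0 t" (is "_ = ?S * _")
      unfolding sum_distrib_right split away by (simp only: mult.assoc)
    also have "\<dots> = block_wt t {j, m} * matching_wt \<pi>0 t"
    proof (cases "matching_wt \<pi>0 t = 0")
      case False
      then have compat: "sum t V = 0" if "V \<in> \<pi> - {{a, j}, {b, m}}" for V
        using matching_wt_nonzeroD[of \<pi>0 t V] that fin\<pi> by (simp add: \<pi>0_def)
      have zero: "block_wt (?s e) {a, j} * block_wt (?s e) {b, m} = 0" if "e \<noteq> - t j \<or> e \<noteq> t m" for e
        using that
      proof
        assume "e \<noteq> - t j"
        then have "block_wt (?s e) {a, j} = 0" using ne by (intro block_wt_arc_unordered) auto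
        then show ?thesis by simp
      next
        assume "e \<noteq> t m"
        then have "block_wt (?s e) {b, m} = 0" using ne by (intro block_wt_arc_unordered) auto
        then show ?thesis by simp
      qed
      have "?S = block_wt t {j, m}"
      proof (cases "t j + t m = 0")
        case True
        note w = merged_arc_weight[OF \<pi> arcs ne gap t compat True]
        have "- t j \<in> {-1, 0, 1}" using pathsD(1)[OF t, of j] by auto
        then have E: "- t j \<in> ?E" using w(1) by simp
        have "?S = (\<Sum>e\<in>{- t j}. cup_wt (ht t a) e * (block_wt (?s e) {a, j} * block_wt (?s e) {b, m}))"
          using E zero by (intro sum.mono_neutral_right) (auto intro: finite_subset[of _ "{-1, 0, 1}"])
        also have "\<dots> = block_wt t {j, m}" using w(2) by simp
        finally show ?thesis .
      next
        case False
        then have "e \<noteq> - t j \<or> e \<noteq> t m" for e by auto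
        from zero[OF this] have "?S = 0" by (intro sum.neutral) simp
        moreover have "block_wt t {j, m} = 0"
          using False \<open>j \<noteq> m\<close> by (intro block_wt_arc_unordered) auto
        ultimately show ?thesis by simp
      qed
      then show ?thesis by simp
    qed simp
    finally show ?thesis unfolding \<pi>' .
  qed
  then show ?thesis
    unfolding gram_sum_adjacent_arc[OF fin \<sigma> ab ne(1) gap] unfolding gram_sum_def \<pi>0_def[symmetric]
    by (intro sum.cong) (auto simp: mult_ac)
qed

text \<open>Both sides change in the same way under contraction of a block of \<open>\<sigma>\<close>. They gain a factor \<open>n\<close>
  if the block is also a block of \<open>\<pi>\<close>, and otherwise they stay the same. By symmetry a singleton may
  be assumed to lie in \<open>\<sigma>\<close>. Without singletons in either partition, \<open>\<sigma>\<close> has an adjacent arc.\<close>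

theorem gram_sum_eq_join:
  assumes "finite A" "\<pi> \<in> nc_matchings A" "\<sigma> \<in> nc_matchings A"
  shows "gram_sum A \<pi> \<sigma> = n ^ card (partition_join A \<pi> \<sigma>)"
  using assms
proof (induction "card A" arbitrary: A \<pi> \<sigma> rule: less_induct)
  case less
  note fin = less.prems(1) and \<pi> = less.prems(2) and \<sigma> = less.prems(3)
  note parts = nc_matchings_partition[OF \<pi>] nc_matchings_partition[OF \<sigma>]
  have IH: "gram_sum (A - S) \<pi>' \<sigma>' = n ^ card (partition_join (A - S) \<pi>' \<sigma>')"
    if "S \<inter> A \<noteq> {}" "\<pi>' \<in> nc_matchings (A - S)" "\<sigma>' \<in> nc_matchings (A - S)" for S \<pi>' \<sigma>'
  proof (rule less.hyps)
    show "card (A - S) < card A" using that(1) fin by (intro psubset_card_mono) auto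
  qed (use fin that in auto)
  have singleton: "gram_sum A \<pi> \<sigma> = n ^ card (partition_join A \<pi> \<sigma>)"
    if a: "{a} \<in> \<sigma>" and \<pi>: "\<pi> \<in> nc_matchings A" and \<sigma>: "\<sigma> \<in> nc_matchings A" for a \<pi> \<sigma>
  proof -
    have aA: "a \<in> A" using a \<sigma> by (auto simp: nc_matchings_def partition_on_def)
    note parts = nc_matchings_partition[OF \<pi>] nc_matchings_partition[OF \<sigma>]
    from \<pi> aA show ?thesis
    proof (cases rule: nc_matchings_block_of)
      case 1
      show ?thesis
        unfolding gram_sum_common_singleton[OF fin \<pi> \<sigma> 1 a]
          card_join_remove_common_block[OF fin parts 1 a]
        using aA nc_matchings_remove_block[OF \<pi> 1] nc_matchings_remove_block[OF \<sigma> a]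
        by (simp add: IH)
    next
      case (2 j)
      show ?thesis
        unfolding gram_sum_shorten_arc[OF fin \<pi> \<sigma> 2(1) a 2(2)]
          card_join_shorten_arc[OF fin parts 2(1) a 2(2)]
        using aA nc_matchings_shorten_arc[OF \<pi> 2(1,2)] nc_matchings_remove_block[OF \<sigma> a]
        by (intro IH) auto
    qed
  qed
  show ?case
  proof (cases "A = {}")
    case True
    then have "\<pi> = {}" "\<sigma> = {}" using parts by (auto simp: partition_on_def)
    moreover have "paths {} 0 = {\<lambda>_. 0}" by (auto simp: paths_def ht_def fun_eq_iff)
    ultimately show ?thesis
      using True by (simp add: gram_sum_def path_wt_def matching_wt_def partition_join_empty)
  next
    case False
    consider a where "{a} \<in> \<sigma>" | a where "{a} \<in> \<pi>" | "\<And>a. {a} \<notin> \<sigma>" "\<And>a. {a} \<notin> \<pi>" by blast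
    then show ?thesis
    proof cases
      case 1
      then show ?thesis using singleton \<pi> \<sigma> by blast
    next
      case 2
      then show ?thesis
        using singleton[OF _ \<sigma> \<pi>] by (simp add: gram_sum_commute[of A \<pi>] partition_join_commute[of A \<pi>])
    next
      case 3
      obtain a b where ab: "a < b" "{a, b} \<in> \<sigma>" and gap: "A \<inter> {a<..<b} = {}"
        using adjacent_arc_exists[OF \<sigma> fin False 3(1)] by metis
      have abA: "a \<in> A" "b \<in> A" using \<sigma> ab by (auto simp: nc_matchings_def partition_on_def)
      obtain j where j: "{a, j} \<in> \<pi>" "j \<noteq> a"
        using nc_matchings_block_of[OF \<pi> abA(1)] 3(2) by metis
      obtain m where m: "{b, m} \<in> \<pi>" "m \<noteq> b"
        using nc_matchings_block_of[OF \<pi> abA(2)] 3(2) by metis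
      show ?thesis
      proof (cases "{a, b} \<in> \<pi>")
        case True
        show ?thesis
          unfolding gram_sum_common_arc[OF fin \<pi> \<sigma> True ab(2,1) gap]
            card_join_remove_common_block[OF fin parts True ab(2)]
          using abA nc_matchings_remove_block[OF \<pi> True] nc_matchings_remove_block[OF \<sigma> ab(2)]
          by (simp add: IH)
      next
        case False
        then have ne: "j \<noteq> b" "m \<noteq> a" using j m by (auto simp: insert_commute)
        show ?thesis
          unfolding gram_sum_merge_arcs[OF fin \<pi> \<sigma> j(1) m(1) ab(2,1) j(2) ne m(2) gap]
            card_join_merge_arcs[OF fin parts j(1) m(1) ab(2) j(2) ne m(2)]
          using abA nc_matchings_merge_arcs[OF \<pi> j(1) m(1) ab(1) j(2) ne m(2) gap]
            nc_matchings_remove_block[OF \<sigma> ab(2)]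
          by (intro IH) auto
      qed
    qed
  qed
qed

end

section \<open>The path of a partition and triangularity\<close>

definition path_of :: "nat set set \<Rightarrow> nat \<Rightarrow> int" where
  "path_of \<pi> i = (if \<exists>j>i. {i, j} \<in> \<pi> then 1 else if \<exists>j<i. {j, i} \<in> \<pi> then -1 else 0)"

lemma path_of_arc:
  assumes "\<pi> \<in> nc_matchings A" "{a, b} \<in> \<pi>" "a < b"
  shows "path_of \<pi> a = 1" "path_of \<pi> b = -1"
proof -
  show "path_of \<pi> a = 1" using assms by (auto simp: path_of_def)
  have "\<not> (\<exists>j>b. {b, j} \<in> \<pi>)"
  proof
    assume "\<exists>j>b. {b, j} \<in> \<pi>"
    then obtain j where j: "j > b" "{b, j} \<in> \<pi>" by blast
    then have "{b, j} = {a, b}"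
      using partition_on_block_unique[OF nc_matchings_partition[OF assms(1)] j(2) assms(2), of b] by simp
    then show False using j assms(3) by (auto simp: doubleton_eq_iff)
  qed
  then show "path_of \<pi> b = -1" using assms by (auto simp: path_of_def)
qed

lemma path_of_singleton:
  assumes "\<pi> \<in> nc_matchings A" "{a} \<in> \<pi>"
  shows "path_of \<pi> a = 0"
proof -
  have "j = a" if "{a, j} \<in> \<pi>" for j
    using partition_on_block_unique[OF nc_matchings_partition[OF assms(1)] that assms(2), of a] by auto
  then have "\<not> (\<exists>j>a. {a, j} \<in> \<pi>)" "\<not> (\<exists>j<a. {j, a} \<in> \<pi>)"
    by (metis less_irrefl, metis insert_commute less_irrefl)
  then show ?thesis by (simp add: path_of_def)
qed

lemma path_of_outside:
  assumes "\<pi> \<in> nc_matchings A" "i \<notin> A"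
  shows "path_of \<pi> i = 0"
proof -
  have "V \<subseteq> A" if "V \<in> \<pi>" for V
    using assms(1) that by (auto simp: nc_matchings_def partition_on_def)
  then show ?thesis using assms(2) by (auto simp: path_of_def)
qed

lemma path_of_eq_0_iff:
  assumes "\<pi> \<in> nc_matchings A" "a \<in> A"
  shows "path_of \<pi> a = 0 \<longleftrightarrow> {a} \<in> \<pi>"
proof
  assume 0: "path_of \<pi> a = 0"
  from assms show "{a} \<in> \<pi>"
  proof (cases rule: nc_matchings_block_of)
    case (2 j)
    then show ?thesis
      using path_of_arc[OF assms(1), of a j] path_of_arc[OF assms(1), of j a] 0
      by (cases "a < j") (auto simp: insert_commute)
  qed
qed (rule path_of_singleton[OF assms(1)])

lemma sum_over_blocks:
  fixes g :: "'a \<Rightarrow> 'b::comm_monoid_add"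
  assumes "finite A" "partition_on A \<pi>"
  shows "sum g A = (\<Sum>V\<in>\<pi>. sum g V)"
proof -
  have A: "A = \<Union> \<pi>" using assms by (simp add: partition_on_def)
  have "finite V" if "V \<in> \<pi>" for V using A assms(1) that by (auto intro: finite_subset)
  moreover have "V \<inter> W = {}" if "V \<in> \<pi>" "W \<in> \<pi>" "V \<noteq> W" for V W
    using assms(2) that by (auto simp: partition_on_def disjoint_def)
  ultimately show ?thesis unfolding A by (subst sum.Union_disjoint) auto
qed

lemma path_of_in_paths:
  assumes fin: "finite A" and \<pi>: "\<pi> \<in> nc_matchings A"
  shows "path_of \<pi> \<in> paths A 0"
proof -
  note part = nc_matchings_partition[OF \<pi>]
  have "0 \<le> ht (path_of \<pi>) i" for i
  proof -
    let ?g = "\<lambda>j. if j \<le> i then path_of \<pi> j else 0"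
    have "ht (path_of \<pi>) i = sum (path_of \<pi>) (A \<inter> {..i})"
      unfolding ht_def
      by (rule sum.mono_neutral_right) (use path_of_outside[OF \<pi>] in auto)
    also have "\<dots> = sum ?g A"
      using fin by (simp add: sum.inter_restrict)
    also have "\<dots> = (\<Sum>V\<in>\<pi>. sum ?g V)" by (rule sum_over_blocks[OF fin part])
    also have "\<dots> \<ge> 0"
    proof (rule sum_nonneg)
      fix V assume V: "V \<in> \<pi>"
      from \<pi> V show "0 \<le> sum ?g V"
      proof (cases rule: nc_matchings_block_cases)
        case (1 a)
        then have "path_of \<pi> a = 0" using path_of_singleton[OF \<pi>] V by simp
        then show ?thesis unfolding 1(1) by simp
      next
        case (2 a b)
        then have "path_of \<pi> a = 1" "path_of \<pi> b = -1" using path_of_arc[OF \<pi>, of a b] V by auto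
        then show ?thesis unfolding 2(1) using 2(2) by simp
      qed
    qed
    finally show ?thesis .
  qed
  moreover have "sum (path_of \<pi>) A = 0"
    unfolding sum_over_blocks[OF fin part]
  proof (rule sum.neutral, rule ballI)
    fix V assume V: "V \<in> \<pi>"
    from \<pi> V show "sum (path_of \<pi>) V = 0"
    proof (cases rule: nc_matchings_block_cases)
      case (1 a)
      then show ?thesis using path_of_singleton[OF \<pi>] V by simp
    next
      case (2 a b)
      then show ?thesis using path_of_arc[OF \<pi>, of a b] V by simp
    qed
  qed
  moreover have "path_of \<pi> i \<in> {-1, 0, 1}" for i by (simp add: path_of_def)
  ultimately show ?thesis using path_of_outside[OF \<pi>] by (auto simp: paths_def)
qed

text \<open>The rank function for triangularity. It detects how far the arcs have been flattened or
  reversed.\<close>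

definition moment :: "nat set \<Rightarrow> (nat \<Rightarrow> int) \<Rightarrow> int" where
  "moment A s = (\<Sum>i\<in>A. int i * s i)"

text \<open>On an arc \<open>a < b\<close> a compatible path has opposite steps, so the arc contributes
  \<open>(b - a) * s b\<close> to the moment. This is minimal exactly if \<open>s b = -1\<close>, as in the path of \<open>\<pi>\<close>.\<close>

lemma moment_path_of_minimal:
  assumes fin: "finite A" and \<pi>: "\<pi> \<in> nc_matchings A" and s: "s \<in> paths A 0"
    and compat: "\<And>V. V \<in> \<pi> \<Longrightarrow> sum s V = 0"
  shows "moment A (path_of \<pi>) \<le> moment A s"
    and "moment A (path_of \<pi>) = moment A s \<Longrightarrow> s = path_of \<pi>"
proof -
  let ?m = "\<lambda>s. \<lambda>i. int i * s i"
  note part = nc_matchings_partition[OF \<pi>]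
  have fin\<pi>: "finite \<pi>" using finite_elements[OF fin part] .
  have block: "sum (?m (path_of \<pi>)) V \<le> sum (?m s) V \<and>
    (sum (?m (path_of \<pi>)) V = sum (?m s) V \<longrightarrow> (\<forall>i\<in>V. s i = path_of \<pi> i))" if V: "V \<in> \<pi>" for V
    using \<pi> V
  proof (cases rule: nc_matchings_block_cases)
    case (1 a)
    then show ?thesis using path_of_singleton[OF \<pi>] compat[OF V] V by simp
  next
    case (2 a b)
    then have sa: "s a = - s b" using compat[OF V] by simp
    have p: "path_of \<pi> a = 1" "path_of \<pi> b = -1" using path_of_arc[OF \<pi>, of a b] V 2 by auto
    show ?thesis using pathsD(1)[OF s, of b] 2 sa p by (auto simp: algebra_simps)
  qed
  have eq: "moment A t = (\<Sum>V\<in>\<pi>. sum (?m t) V)" for t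
    unfolding moment_def by (rule sum_over_blocks[OF fin part])
  show "moment A (path_of \<pi>) \<le> moment A s" unfolding eq by (rule sum_mono) (use block in blast)
  assume "moment A (path_of \<pi>) = moment A s"
  then have *: "sum (?m (path_of \<pi>)) V = sum (?m s) V" if "V \<in> \<pi>" for V
    unfolding eq using sum_mono_inv[OF _ _ that fin\<pi>, of "\<lambda>V. sum (?m (path_of \<pi>)) V"
      "\<lambda>V. sum (?m s) V"] block by auto
  show "s = path_of \<pi>"
  proof
    fix i
    show "s i = path_of \<pi> i"
    proof (cases "i \<in> A")
      case True
      then obtain V where "V \<in> \<pi>" "i \<in> V" using part by (auto simp: partition_on_def)
      then show ?thesis using block * by blast
    next
      case False
      then show ?thesis using pathsD(2)[OF s] path_of_outside[OF \<pi>] by simp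
    qed
  qed
qed

lemma path_of_insert_singleton:
  assumes "\<pi> \<in> nc_matchings A" "a \<notin> A"
  shows "path_of (insert {a} \<pi>) = path_of \<pi>"
proof
  fix i
  have "{x, y} \<in> insert {a} \<pi> \<longleftrightarrow> {x, y} \<in> \<pi>" if "x < y" for x y
    using that by (auto simp: doubleton_eq_iff)
  then have "(\<exists>j>i. {i, j} \<in> insert {a} \<pi>) \<longleftrightarrow> (\<exists>j>i. {i, j} \<in> \<pi>)"
    "(\<exists>j<i. {j, i} \<in> insert {a} \<pi>) \<longleftrightarrow> (\<exists>j<i. {j, i} \<in> \<pi>)" by blast+
  then show "path_of (insert {a} \<pi>) i = path_of \<pi> i" unfolding path_of_def by simp
qed

lemma path_of_insert_arc:
  assumes \<pi>: "\<pi> \<in> nc_matchings A" and ab: "a \<notin> A" "b \<notin> A" "a < b"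
  shows "path_of (insert {a, b} \<pi>) = (path_of \<pi>)(a := 1, b := -1)"
proof
  fix i
  have VA: "V \<subseteq> A" if "V \<in> \<pi>" for V
    using \<pi> that by (auto simp: nc_matchings_def partition_on_def)
  have *: "{x, y} \<in> insert {a, b} \<pi> \<longleftrightarrow> x = a \<and> y = b \<or> {x, y} \<in> \<pi>" if "x < y" for x y
    using that ab(3) by (auto simp: doubleton_eq_iff)
  have up: "(\<exists>j>i. {i, j} \<in> insert {a, b} \<pi>) \<longleftrightarrow> i = a \<or> (\<exists>j>i. {i, j} \<in> \<pi>)"
    using *[of i] ab(3) by (metis (no_types))
  have down: "(\<exists>j<i. {j, i} \<in> insert {a, b} \<pi>) \<longleftrightarrow> i = b \<or> (\<exists>j<i. {j, i} \<in> \<pi>)"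
    using *[of _ i] ab(3) by (metis (no_types))
  have "\<not> (\<exists>j>b. {b, j} \<in> \<pi>)" using VA[of "{b, _}"] ab(2) by auto
  then show "path_of (insert {a, b} \<pi>) i = ((path_of \<pi>)(a := 1, b := -1)) i"
    unfolding path_of_def[of "insert {a, b} \<pi>"] up down
    using ab(3) by (cases "i = b"; cases "i = a") (simp_all add: path_of_def)
qed

text \<open>Singletons are visible as flat steps. An adjacent arc of \<open>\<sigma>\<close> must also be an arc of \<open>\<pi>\<close>: its
  ends are an up and a down step, and if they had other partners in \<open>\<pi>\<close>, the two arcs of \<open>\<pi>\<close> would
  cross. Remove the common block and use induction.\<close>

lemma inj_on_path_of:
  assumes "finite A"
  shows "inj_on path_of (nc_matchings A)"
proof (rule inj_onI)
  fix \<pi> \<sigma>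
  assume "\<pi> \<in> nc_matchings A" "\<sigma> \<in> nc_matchings A" "path_of \<pi> = path_of \<sigma>"
  with assms show "\<pi> = \<sigma>"
  proof (induction "card A" arbitrary: A \<pi> \<sigma> rule: less_induct)
    case less
    note fin = less.prems(1) and \<pi> = less.prems(2) and \<sigma> = less.prems(3) and eq = less.prems(4)
    have IH: "\<pi> = \<sigma>" if S: "S \<in> \<pi>" "S \<in> \<sigma>" and eq': "path_of (\<pi> - {S}) = path_of (\<sigma> - {S})" for S
    proof -
      have "S \<noteq> {}" "S \<subseteq> A" using S \<pi> by (auto simp: nc_matchings_def partition_on_def)
      then have "card (A - S) < card A" using fin by (intro psubset_card_mono) auto
      then have "\<pi> - {S} = \<sigma> - {S}"
        using less.hyps[OF _ _ nc_matchings_remove_block[OF \<pi> S(1)] nc_matchings_remove_block[OF \<sigma> S(2)] eq']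
          fin by simp
      then show ?thesis using S by blast
    qed
    show ?case
    proof (cases "A = {}")
      case True
      then show ?thesis using \<pi> \<sigma> by (auto simp: nc_matchings_def partition_on_def)
    next
      case A: False
      show ?thesis
      proof (cases "\<exists>a. {a} \<in> \<sigma>")
        case True
        then obtain a where a: "{a} \<in> \<sigma>" by blast
        then have aA: "a \<in> A" using \<sigma> by (auto simp: nc_matchings_def partition_on_def)
        then have a': "{a} \<in> \<pi>"
          using path_of_eq_0_iff[OF \<pi>] path_of_eq_0_iff[OF \<sigma>] eq a by simp
        have "path_of (\<rho> - {{a}}) = path_of \<rho>" if "\<rho> \<in> nc_matchings A" "{a} \<in> \<rho>" for \<rho>
          using path_of_insert_singleton[OF nc_matchings_remove_block[OF that], of a] that(2)
          by (simp add: insert_absorb)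
        then show ?thesis using IH[OF a' a] a a' \<pi> \<sigma> eq by simp
      next
        case False
        then obtain a b where ab: "a < b" "{a, b} \<in> \<sigma>" "A \<inter> {a<..<b} = {}"
          using adjacent_arc_exists[OF \<sigma> fin A] by blast
        have abA: "a \<in> A" "b \<in> A" using ab \<sigma> by (auto simp: nc_matchings_def partition_on_def)
        have pab: "path_of \<pi> a = 1" "path_of \<pi> b = -1" using path_of_arc[OF \<sigma> ab(2,1)] eq by auto
        obtain j where j: "{a, j} \<in> \<pi>" "a < j"
          using pab(1) unfolding path_of_def by (auto split: if_splits)
        obtain m where m: "{b, m} \<in> \<pi>" "m < b"
          using pab(2) unfolding path_of_def by (auto simp: insert_commute split: if_splits)
        have "{a, b} \<in> \<pi>"
        proof (rule ccontr)
          assume "{a, b} \<notin> \<pi>"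
          then have "j \<noteq> b" "m \<noteq> a" using j m by (auto simp: insert_commute)
          then show False
            using linked_arcs_positions[OF \<pi> j(1) m(1) ab(1) _ _ _ _ ab(3)] j m by auto
        qed
        moreover have "path_of (\<rho> - {{a, b}}) = (path_of \<rho>)(a := 0, b := 0)"
          if "\<rho> \<in> nc_matchings A" "{a, b} \<in> \<rho>" for \<rho>
        proof -
          note r = nc_matchings_remove_block[OF that]
          have "path_of \<rho> = (path_of (\<rho> - {{a, b}}))(a := 1, b := -1)"
            using path_of_insert_arc[OF r _ _ ab(1)] that(2) by (simp add: insert_absorb)
          then show ?thesis
            using path_of_outside[OF r, of a] path_of_outside[OF r, of b] by (auto simp: fun_eq_iff)
        qed
        ultimately show ?thesis using IH[OF _ ab(2)] ab(2) \<pi> \<sigma> eq by simp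
      qed
    qed
  qed
qed

text \<open>A nonempty path without flat steps has a peak, for instance at its first down step.
  The two steps of the peak become an adjacent arc, and induction deals with the rest.\<close>

lemma path_of_surj:
  assumes "finite A" "s \<in> paths A 0"
  shows "\<exists>\<pi>\<in>nc_matchings A. path_of \<pi> = s"
  using assms
proof (induction "card A" arbitrary: A s rule: less_induct)
  case less
  note fin = less.prems(1) and s = less.prems(2)
  show ?case
  proof (cases "\<exists>a\<in>A. s a = 0")
    case True
    then obtain a where a: "a \<in> A" "s a = 0" by blast
    then have "s \<in> paths (A - {a}) 0" using paths_flat_at[OF fin, of a 0] s by blast
    then obtain \<pi> where \<pi>: "\<pi> \<in> nc_matchings (A - {a})" "path_of \<pi> = s"
      using less.hyps[OF card_Diff1_less[OF fin a(1)]] fin by auto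
    have "insert {a} \<pi> \<in> nc_matchings A"
      using nc_matchings_insert_singleton[OF \<pi>(1), of a] a by (simp add: insert_absorb)
    then show ?thesis using path_of_insert_singleton[OF \<pi>(1), of a] \<pi>(2) by auto
  next
    case False
    then have nz: "s i = 1 \<or> s i = -1" if "i \<in> A" for i
      using pathsD(1)[OF s, of i] that by auto
    show ?thesis
    proof (cases "A = {}")
      case True
      then have "{} \<in> nc_matchings A"
        by (simp add: nc_matchings_def partition_on_def noncrossing_def)
      moreover have "path_of {} = s"
        using pathsD(2)[OF s] True by (auto simp: path_of_def fun_eq_iff)
      ultimately show ?thesis by blast
    next
      case A: False
      have "\<exists>i\<in>A. s i = -1"
      proof (rule ccontr)
        assume "\<not> (\<exists>i\<in>A. s i = -1)"
        then have "sum s A = (\<Sum>i\<in>A. 1)" using nz by (intro sum.cong) auto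
        then show False using pathsD(4)[OF s] A fin by simp
      qed
      then have D: "{i \<in> A. s i = -1} \<noteq> {}" by blast
      define b where "b = Min {i \<in> A. s i = -1}"
      have b: "b \<in> A" "s b = -1" using Min_in[OF _ D] fin by (auto simp: b_def)
      have bmin: "s i = 1" if "i \<in> A" "i < b" for i
      proof -
        have "s i \<noteq> -1"
        proof
          assume "s i = -1"
          then have "b \<le> i" unfolding b_def using fin that(1) by (intro Min_le) auto
          then show False using that by simp
        qed
        then show ?thesis using nz that by auto
      qed
      have C: "{i \<in> A. i < b} \<noteq> {}"
      proof
        assume "{i \<in> A. i < b} = {}"
        then have "s i = 0" if "i < b" for i using pathsD(2)[OF s, of i] that by auto
        then have "ht s b = sum s {b}"
          unfolding ht_def by (intro sum.mono_neutral_right) auto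
        then show False using pathsD(3)[OF s, of b] b by simp
      qed
      define a where "a = Max {i \<in> A. i < b}"
      have a: "a \<in> A" "a < b" using Max_in[OF _ C] fin by (auto simp: a_def)
      have gap: "A \<inter> {a<..<b} = {}"
      proof -
        have "i \<le> a" if "i \<in> A" "i < b" for i
          unfolding a_def using fin that by (intro Max_ge) auto
        then show ?thesis by force
      qed
      have sab: "s a = 1" "s a + s b = 0" using bmin a b by auto
      have "card (A - {a, b}) < card A" using a fin by (intro psubset_card_mono) auto
      then obtain \<pi> where \<pi>: "\<pi> \<in> nc_matchings (A - {a, b})" "path_of \<pi> = s(a := 0, b := 0)"
        using less.hyps[OF _ _ paths_erase_pair[OF fin a(1) b(1) a(2) gap s sab(2)]] fin by auto
      have "insert {a, b} \<pi> \<in> nc_matchings (insert a (insert b (A - {a, b})))"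
        by (rule nc_matchings_insert_arc[OF \<pi>(1) _ _ a(2)]) (use gap in auto)
      moreover have "insert a (insert b (A - {a, b})) = A" using a b by auto
      moreover have "path_of (insert {a, b} \<pi>) = s"
        using path_of_insert_arc[OF \<pi>(1) _ _ a(2)] \<pi>(2) sab b by (auto simp: fun_eq_iff)
      ultimately show ?thesis by metis
    qed
  qed
qed

lemma bij_betw_path_of:
  assumes "finite A"
  shows "bij_betw path_of (nc_matchings A) (paths A 0)"
  unfolding bij_betw_def
  using inj_on_path_of[OF assms] path_of_in_paths[OF assms] path_of_surj[OF assms] by blast

text \<open>In the Leibniz expansion, a nonzero term for \<open>p\<close> needs \<open>r i \<le> r (p i)\<close> for all \<open>i\<close>, strictly
  where \<open>p\<close> moves \<open>i\<close>. Both sides have the same sum, so \<open>p\<close> is the identity. Stating triangularity by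
  a rank avoids sorting the index list.\<close>

lemma det_triangular_rank:
  fixes X :: "'a::comm_ring_1 mat" and r :: "nat \<Rightarrow> int"
  assumes X: "X \<in> carrier_mat N N"
    and tri: "\<And>i j. i < N \<Longrightarrow> j < N \<Longrightarrow> X $$ (i, j) \<noteq> 0 \<Longrightarrow> i = j \<or> r i < r j"
  shows "det X = (\<Prod>i<N. X $$ (i, i))"
proof -
  have "(\<Prod>i = 0..<N. X $$ (i, p i)) = 0" if p: "p permutes {0..<N}" and "p \<noteq> id" for p
  proof (rule ccontr)
    assume nz: "(\<Prod>i = 0..<N. X $$ (i, p i)) \<noteq> 0"
    have pN: "p i < N" if "i < N" for i using permutes_in_image[OF p, of i] that by simp
    have le: "i = p i \<or> r i < r (p i)" if "i < N" for i
    proof (rule tri[OF that pN[OF that]])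
      show "X $$ (i, p i) \<noteq> 0"
      proof
        assume "X $$ (i, p i) = 0"
        then have "(\<Prod>i = 0..<N. X $$ (i, p i)) = 0"
          using that by (intro prod_zero) (auto intro!: bexI[of _ i])
        then show False using nz by simp
      qed
    qed
    have "(\<Sum>i = 0..<N. r (p i)) = (\<Sum>i = 0..<N. r i)"
      using sum.permute[OF p, of r] by (simp add: comp_def)
    moreover have "\<exists>i. i < N \<and> p i \<noteq> i"
    proof (rule ccontr)
      assume *: "\<not> (\<exists>i. i < N \<and> p i \<noteq> i)"
      have "p i = i" for i using * permutes_not_in[OF p, of i] by (cases "i < N") auto
      then show False using \<open>p \<noteq> id\<close> by (auto simp: fun_eq_iff)
    qed
    then obtain i where "i < N" "p i \<noteq> i" by blast
    then have "(\<Sum>i = 0..<N. r i) < (\<Sum>i = 0..<N. r (p i))"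
      using le by (intro sum_strict_mono_ex1) (force intro: order.strict_implies_order)+
    ultimately show False by simp
  qed
  then have "det X = (\<Sum>p\<in>{id}. signof p * (\<Prod>i = 0..<N. X $$ (i, p i)))"
    unfolding det_def'[OF X]
    by (intro sum.mono_neutral_right) (auto simp: finite_permutations permutes_id)
  also have "\<dots> = (\<Prod>i<N. X $$ (i, i))" by (simp add: lessThan_atLeast0)
  finally show ?thesis .
qed

context path_weights
begin

lemma matching_wt_path_of:
  assumes "\<pi> \<in> nc_matchings A"
  shows "matching_wt \<pi> (path_of \<pi>) = 1"
  unfolding matching_wt_def
proof (rule prod.neutral, rule ballI)
  fix V assume V: "V \<in> \<pi>"
  from assms V show "block_wt (path_of \<pi>) V = 1"
  proof (cases rule: nc_matchings_block_cases)
    case (1 a)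
    then show ?thesis using path_of_singleton[OF assms] V by (simp add: block_wt_singleton)
  next
    case (2 a b)
    then show ?thesis using path_of_arc[OF assms, of a b] V by (simp add: block_wt_arc)
  qed
qed

lemma det_join_gram:
  assumes fin: "finite A" and ps: "distinct ps" "set ps = nc_matchings A"
  shows "det (mat (length ps) (length ps) (\<lambda>(i, j). n ^ card (partition_join A (ps ! i) (ps ! j)))) =
    (\<Prod>s\<in>paths A 0. path_wt A s)"
proof -
  let ?N = "length ps"
  let ?s = "\<lambda>l. path_of (ps ! l)"
  \<comment> \<open>\<open>Y\<close> is \<open>D X\<^sup>T\<close>, which is triangular for the opposite rank\<close>
  define X where "X = mat ?N ?N (\<lambda>(i, l). matching_wt (ps ! i) (?s l))"
  define Y where "Y = mat ?N ?N (\<lambda>(l, j). path_wt A (?s l) * matching_wt (ps ! j) (?s l))"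
  have nc: "ps ! i \<in> nc_matchings A" if "i < ?N" for i using ps(2) that nth_mem by blast
  have "bij_betw (\<lambda>l. ps ! l) {..<?N} (nc_matchings A)"
    using bij_betw_nth[OF ps(1) refl ps(2)[symmetric]] .
  from bij_betw_trans[OF this bij_betw_path_of[OF fin]]
  have bij: "bij_betw ?s {..<?N} (paths A 0)" by (simp add: comp_def)
  have G: "mat ?N ?N (\<lambda>(i, j). n ^ card (partition_join A (ps ! i) (ps ! j))) = X * Y"
  proof (rule eq_matI)
    fix i j assume "i < dim_row (X * Y)" "j < dim_col (X * Y)"
    then have ij: "i < ?N" "j < ?N" by (auto simp: X_def Y_def)
    have "(X * Y) $$ (i, j) = (\<Sum>l<?N. path_wt A (?s l) * matching_wt (ps ! i) (?s l) * matching_wt (ps ! j) (?s l))"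
      using ij by (simp add: X_def Y_def scalar_prod_def lessThan_atLeast0 mult_ac)
    also have "\<dots> = gram_sum A (ps ! i) (ps ! j)"
      unfolding gram_sum_def by (rule sum.reindex_bij_betw[OF bij])
    also have "\<dots> = n ^ card (partition_join A (ps ! i) (ps ! j))"
      by (rule gram_sum_eq_join[OF fin nc[OF ij(1)] nc[OF ij(2)]])
    finally show "mat ?N ?N (\<lambda>(i, j). n ^ card (partition_join A (ps ! i) (ps ! j))) $$ (i, j) = (X * Y) $$ (i, j)"
      using ij by simp
  qed (auto simp: X_def Y_def)
  have tri: "i = l \<or> moment A (?s i) < moment A (?s l)"
    if il: "i < ?N" "l < ?N" and nz: "matching_wt (ps ! i) (?s l) \<noteq> 0" for i l
  proof -
    have compat: "sum (?s l) V = 0" if "V \<in> ps ! i" for V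
      using matching_wt_nonzeroD[OF finite_matching[OF fin nc[OF il(1)]] nz that] .
    note m = moment_path_of_minimal[OF fin nc[OF il(1)] path_of_in_paths[OF fin nc[OF il(2)]] compat]
    show ?thesis
    proof (cases "moment A (?s i) = moment A (?s l)")
      case True
      then have "?s l = ?s i" using m(2) by blast
      then show ?thesis using bij il by (auto simp: bij_betw_def inj_on_def)
    next
      case False
      then show ?thesis using m(1) by simp
    qed
  qed
  have "det X = (\<Prod>i<?N. X $$ (i, i))"
    by (rule det_triangular_rank[of _ _ "\<lambda>i. moment A (?s i)"]) (use tri in \<open>auto simp: X_def\<close>)
  also have "\<dots> = 1" using matching_wt_path_of nc by (intro prod.neutral) (auto simp: X_def)
  finally have detX: "det X = 1" .
  have "det Y = (\<Prod>i<?N. Y $$ (i, i))"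
    by (rule det_triangular_rank[of _ _ "\<lambda>i. - moment A (?s i)"]) (use tri in \<open>force simp: Y_def\<close>)+
  also have "\<dots> = (\<Prod>i<?N. path_wt A (?s i))"
    using matching_wt_path_of nc by (intro prod.cong) (auto simp: Y_def)
  also have "\<dots> = (\<Prod>s\<in>paths A 0. path_wt A s)" by (rule prod.reindex_bij_betw[OF bij])
  finally have detY: "det Y = (\<Prod>s\<in>paths A 0. path_wt A s)" .
  show ?thesis unfolding G using det_mult[of X ?N Y] detX detY by (simp add: X_def Y_def)
qed

end

section \<open>Counting up steps\<close>

definition num_paths :: "nat \<Rightarrow> int \<Rightarrow> int" where
  "num_paths k h = int (card (paths {1..k} h))"

definition num_ups :: "nat \<Rightarrow> int \<Rightarrow> int \<Rightarrow> int" where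
  "num_ups k h r = (\<Sum>s\<in>paths {1..k} h. int (card {i \<in> {1..k}. s i = 1 \<and> ht s i = r}))"

lemma ht_eq_sum:
  assumes "\<And>i. i \<notin> {1..k} \<Longrightarrow> s i = 0" "k \<le> i"
  shows "ht s i = sum s {1..k}"
  unfolding ht_def by (rule sum.mono_neutral_right) (use assms in auto)

lemma ht_at_end: "s \<in> paths {1..k} h \<Longrightarrow> k \<le> i \<Longrightarrow> ht s i = h"
  using ht_eq_sum[of k s i] pathsD(2,4)[of s "{1..k}" h] by auto

lemma paths_neg: "h < 0 \<Longrightarrow> paths {1..k} h = {}"
  using ht_at_end[of _ k h k] pathsD(3)[of _ "{1..k}" h k] by (metis all_not_in_conv le_refl not_le)

lemma sum_paths_last_step:
  fixes F :: "(nat \<Rightarrow> int) \<Rightarrow> 'b::comm_monoid_add"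
  assumes h: "0 \<le> h"
  shows "(\<Sum>s\<in>paths {1..Suc k} h. F s) =
    (\<Sum>e\<in>{-1, 0, 1}. \<Sum>s\<in>paths {1..k} (h - e). F (s(Suc k := e)))"
proof -
  have "(\<Sum>s\<in>paths {1..Suc k} h. F s) =
    (\<Sum>(e, s)\<in>Sigma {-1, 0, 1} (\<lambda>e. paths {1..k} (h - e)). F (s(Suc k := e)))"
  proof (rule sum.reindex_bij_witness)
    fix s assume s: "s \<in> paths {1..Suc k} h"
    show "(case (s (Suc k), s(Suc k := 0)) of (e, s) \<Rightarrow> s(Suc k := e)) = s" by simp
    show "(case (s (Suc k), s(Suc k := 0)) of (e, s) \<Rightarrow> F (s(Suc k := e))) = F s" by simp
    define t where "t = s(Suc k := 0)"
    have t0: "t i = 0" if "i \<notin> {1..k}" for i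
      using that pathsD(2)[OF s, of i] by (auto simp: t_def)
    have small: "ht t i = ht s i" if "i \<le> k" for i
      using that by (simp add: t_def ht_fun_upd)
    have tk: "ht s k = h - s (Suc k)"
      using ht_at_end[OF s, of "Suc k"] by (simp add: ht_def)
    have "0 \<le> ht t i" for i
    proof (cases "i \<le> k")
      case True
      then show ?thesis using small pathsD(3)[OF s] by simp
    next
      case False
      then have "ht t i = ht t k" using ht_eq_sum[of k t i, OF t0] ht_eq_sum[of k t k, OF t0] by simp
      then show ?thesis using small[of k] pathsD(3)[OF s, of k] by simp
    qed
    moreover have "sum t {1..k} = h - s (Suc k)"
      using ht_eq_sum[of k t k, OF t0] small[of k] tk by simp
    moreover have "t i \<in> {-1, 0, 1}" for i using pathsD(1)[OF s, of i] by (simp add: t_def)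
    ultimately have "t \<in> paths {1..k} (h - s (Suc k))" using t0 by (auto simp: paths_def)
    then show "(s (Suc k), s(Suc k := 0)) \<in> Sigma {-1, 0, 1} (\<lambda>e. paths {1..k} (h - e))"
      using pathsD(1)[OF s, of "Suc k"] by (simp add: t_def)
  next
    fix es assume "es \<in> Sigma {-1, 0, 1} (\<lambda>e. paths {1..k} (h - e))"
    then obtain e s where es: "es = (e, s)" "e \<in> {-1, 0, 1}" and s: "s \<in> paths {1..k} (h - e)" by blast
    have s0: "s (Suc k) = 0" using pathsD(2)[OF s] by simp
    define t where "t = s(Suc k := e)"
    have "0 \<le> ht t i" for i
    proof (cases "i \<le> k")
      case True
      then show ?thesis using pathsD(3)[OF s, of i] by (simp add: t_def ht_fun_upd)
    next
      case False
      then have "ht t i = h" using ht_at_end[OF s, of i] s0 by (simp add: t_def ht_fun_upd)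
      then show ?thesis using h by simp
    qed
    moreover have "sum t {1..Suc k} = h"
    proof -
      have "sum t {1..k} = sum s {1..k}" by (rule sum.cong) (auto simp: t_def)
      then show ?thesis using pathsD(4)[OF s] by (simp add: t_def)
    qed
    moreover have "t i \<in> {-1, 0, 1}" for i using pathsD(1)[OF s, of i] es by (auto simp: t_def)
    moreover have "t i = 0" if "i \<notin> {1..Suc k}" for i
      using that pathsD(2)[OF s, of i] by (auto simp: t_def)
    ultimately have "t \<in> paths {1..Suc k} h" by (auto simp: paths_def)
    then show "(case es of (e, s) \<Rightarrow> s(Suc k := e)) \<in> paths {1..Suc k} h"
      by (simp add: es t_def)
    show "((case es of (e, s) \<Rightarrow> s(Suc k := e)) (Suc k),
        (case es of (e, s) \<Rightarrow> s(Suc k := e))(Suc k := 0)) = es"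
      using s0 by (auto simp: es fun_eq_iff)
  qed
  also have "\<dots> = (\<Sum>e\<in>{-1, 0, 1}. \<Sum>s\<in>paths {1..k} (h - e). F (s(Suc k := e)))"
    by (rule sum.Sigma[symmetric]) (auto simp: finite_paths)
  finally show ?thesis .
qed

lemma num_paths_neg: "h < 0 \<Longrightarrow> num_paths k h = 0"
  unfolding num_paths_def by (subst paths_neg) auto

lemma num_paths_0: "num_paths 0 h = (if h = 0 then 1 else 0)"
proof -
  have "paths {1..0} h = (if h = 0 then {\<lambda>_. 0} else {})"
    by (auto simp: paths_def ht_def fun_eq_iff)
  then show ?thesis by (simp add: num_paths_def)
qed

lemma num_paths_Suc:
  assumes "0 \<le> h"
  shows "num_paths (Suc k) h = num_paths k (h - 1) + num_paths k h + num_paths k (h + 1)"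
  using sum_paths_last_step[OF assms, of "\<lambda>_. 1 :: int" k] by (simp add: num_paths_def)

lemma num_ups_Suc:
  assumes "0 \<le> h"
  shows "num_ups (Suc k) h r =
    num_ups k (h - 1) r + num_ups k h r + num_ups k (h + 1) r + (if h = r then num_paths k (r - 1) else 0)"
proof -
  let ?c = "\<lambda>k s. int (card {i \<in> {1..k}. s i = 1 \<and> ht s i = r})"
  have "?c (Suc k) (s(Suc k := e)) = ?c k s + (if e = 1 \<and> h = r then 1 else 0)"
    if s: "s \<in> paths {1..k} (h - e)" for s e
  proof -
    have s0: "s (Suc k) = 0" using pathsD(2)[OF s] by simp
    have "ht (s(Suc k := e)) (Suc k) = h"
      using ht_at_end[OF s, of "Suc k"] s0 by (simp add: ht_fun_upd)
    moreover have "{i \<in> {1..k}. (s(Suc k := e)) i = 1 \<and> ht (s(Suc k := e)) i = r} =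
      {i \<in> {1..k}. s i = 1 \<and> ht s i = r}"
      by (auto simp: ht_fun_upd)
    moreover have "{i \<in> {1..Suc k}. P i} = {i \<in> {1..k}. P i} \<union> (if P (Suc k) then {Suc k} else {})"
      for P by (auto simp: le_Suc_eq)
    ultimately have "{i \<in> {1..Suc k}. (s(Suc k := e)) i = 1 \<and> ht (s(Suc k := e)) i = r} =
      {i \<in> {1..k}. s i = 1 \<and> ht s i = r} \<union> (if e = 1 \<and> h = r then {Suc k} else {})"
      by simp
    then show ?thesis by simp
  qed
  then have "num_ups (Suc k) h r =
    (\<Sum>e\<in>{-1, 0, 1}. \<Sum>s\<in>paths {1..k} (h - e). ?c k s + (if e = 1 \<and> h = r then 1 else 0))"
    unfolding num_ups_def sum_paths_last_step[OF assms] by (intro sum.cong refl) simp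
  then show ?thesis by (simp add: num_ups_def num_paths_def sum.distrib)
qed

lemma num_ups_0: "num_ups 0 h r = 0"
  by (simp add: num_ups_def)

text \<open>The number of paths from height \<open>r\<close> to height \<open>h\<close> is the sum of the numbers of paths
  from 0 to \<open>r + h - 2j\<close>, and convolving with the paths up to the marked step shifts the target by
  \<open>r\<close>. This explains the formula; the proof verifies that both sides satisfy the same recursion in
  the last step. Shifting the summation index by one absorbs the boundary terms of the recursion,
  except at \<open>h = r\<close>, where the last step itself can be the marked one.\<close>

lemma num_ups_eq:
  assumes r: "1 \<le> r"
  shows "num_ups k (int h) (int r) = (\<Sum>j\<le>min r h. num_paths k (int (2 * r + h) - 2 * int j))"
proof (induction k arbitrary: h)
  case 0
  have "int (2 * r + h) - 2 * int j \<noteq> 0" if "j \<le> min r h" for j using that r by auto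
  then show ?case by (simp add: num_ups_0 num_paths_0)
next
  case (Suc k)
  \<comment> \<open>The recursion for \<open>num_paths\<close> turns the sum for \<open>Suc k\<close> into \<open>S m\<close> at three neighbouring targets,
     while the induction hypothesis gives sums with different upper limits.\<close>
  define S where "S m y = (\<Sum>j\<le>m. num_paths k (y - 2 * int j))" for m :: nat and y :: int
  define m where "m = min r h"
  define y where "y = int (2 * r + h)"
  have "(\<Sum>j\<le>m. num_paths (Suc k) (y - 2 * int j)) =
    (\<Sum>j\<le>m. num_paths k (y - 1 - 2 * int j) + num_paths k (y - 2 * int j) + num_paths k (y + 1 - 2 * int j))"
  proof (rule sum.cong)
    fix j assume "j \<in> {..m}"
    then have "0 \<le> y - 2 * int j" by (auto simp: y_def m_def)
    then show "num_paths (Suc k) (y - 2 * int j) =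
      num_paths k (y - 1 - 2 * int j) + num_paths k (y - 2 * int j) + num_paths k (y + 1 - 2 * int j)"
      using num_paths_Suc[of "y - 2 * int j" k] by (simp add: algebra_simps)
  qed simp
  also have "\<dots> = S m (y - 1) + S m y + S m (y + 1)"
    by (simp add: S_def sum.distrib)
  finally have L: "(\<Sum>j\<le>m. num_paths (Suc k) (y - 2 * int j)) = S m (y - 1) + S m y + S m (y + 1)" .
  have same: "num_ups k (int h) (int r) = S m y"
    unfolding Suc.IH S_def m_def y_def by simp
  have above: "num_ups k (int h + 1) (int r) = S (min r (Suc h)) (y + 1)"
    using Suc.IH[of "Suc h"] by (simp add: S_def y_def add_ac)
  have below: "num_ups k (int h - 1) (int r) = (if h = 0 then 0 else S (min r (h - 1)) (y - 1))"
  proof (cases h)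
    case 0
    then show ?thesis unfolding num_ups_def by (subst paths_neg) auto
  next
    case (Suc h')
    then show ?thesis using Suc.IH[of h'] by (simp add: S_def y_def)
  qed
  have S_Suc: "S (Suc l) z = S l z + num_paths k (z - 2 * int (Suc l))" for l z
    by (simp add: S_def)
  have "S m (y - 1) + S m (y + 1) =
    (if h = 0 then 0 else S (min r (h - 1)) (y - 1)) + S (min r (Suc h)) (y + 1) +
    (if h = r then num_paths k (int r - 1) else 0)"
  proof -
    consider "h = 0" | h' where "h = Suc h'" "h < r" | h' where "h = Suc h'" "h = r" | "h > r"
      using less_linear[of h r] by (cases h) auto
    then show ?thesis
    proof cases
      case 1
      then have "min r (Suc h) = Suc 0" "m = 0" "h \<noteq> r" using r by (auto simp: m_def)
      then show ?thesis using 1 S_Suc[of 0 "y + 1"] by (simp add: S_def y_def)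
    next
      case 2
      then have "min r (Suc h) = Suc h" "m = Suc h'" "min r (h - 1) = h'" "h \<noteq> r" by (auto simp: m_def)
      then show ?thesis using 2 S_Suc[of h' "y - 1"] S_Suc[of h "y + 1"] by simp
    next
      case 3
      then have "min r (Suc h) = m" "m = Suc h'" "min r (h - 1) = h'" by (auto simp: m_def)
      moreover have "y - 1 - 2 * int (Suc h') = int r - 1" using 3 by (simp add: y_def)
      ultimately show ?thesis using 3 S_Suc[of h' "y - 1"] by simp
    next
      case 4
      then have "min r (Suc h) = m" "min r (h - 1) = m" "h \<noteq> 0" "h \<noteq> r" using r by (auto simp: m_def)
      then show ?thesis by simp
    qed
  qed
  then show ?case
    unfolding num_ups_Suc[of "int h", simplified] same above below
    using L unfolding m_def[symmetric] y_def[symmetric] by simp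
qed

text \<open>The number of paths from 0 to \<open>h\<close> with \<open>m\<close> steps, none of them flat, for nonnegative
  \<open>h\<close>, by the reflection principle.\<close>

definition ballot :: "nat \<Rightarrow> int \<Rightarrow> int" where
  "ballot m h = (if even (int m + h)
     then choose_int m ((int m - h) div 2) - choose_int m ((int m - h) div 2 - 1) else 0)"

lemma choose_int_Suc: "choose_int (Suc m) j = choose_int m j + choose_int m (j - 1)"
proof -
  consider "j < 0" | "j = 0" | "j > 0" by linarith
  then show ?thesis
  proof cases
    case 3
    then have "nat j = Suc (nat (j - 1))" by simp
    then show ?thesis using 3 by (simp add: choose_int_def)
  qed (auto simp: choose_int_def)
qed

lemma ballot_Suc: "ballot (Suc m) h = ballot m (h - 1) + ballot m (h + 1)"
proof (cases "even (int (Suc m) + h)")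
  case True
  then obtain j where j: "int (Suc m) - h = 2 * j" by (elim evenE) (metis add_diff_cancel_left' even_diff evenE even_add True)
  then have "(int (Suc m) - h) div 2 = j" "(int m - (h - 1)) div 2 = j" "(int m - (h + 1)) div 2 = j - 1"
    by auto
  moreover have "even (int m + (h - 1))" "even (int m + (h + 1))" using True by auto
  ultimately show ?thesis using True by (simp add: ballot_def choose_int_Suc)
qed (auto simp: ballot_def)

lemma choose_int_symmetric: "choose_int m (int m - j) = choose_int m j"
proof (cases "0 \<le> j \<and> j \<le> int m")
  case True
  then have "nat (int m - j) = m - nat j" "nat j \<le> m" by auto
  then show ?thesis using True by (simp add: choose_int_def binomial_symmetric[symmetric])
next
  case False
  then show ?thesis by (auto simp: choose_int_def)
qed

lemma ballot_minus_1: "ballot m (-1) = 0"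
proof (cases "even (int m - 1)")
  case True
  then obtain j where "int m - 1 = 2 * j" by (elim evenE)
  then have "int m = 2 * j + 1" by simp
  then have "(int m + 1) div 2 = j + 1" and "int m - j = j + 1" by auto
  then show ?thesis using choose_int_symmetric[of m j] by (simp add: ballot_def add.commute)
qed (simp add: ballot_def)

lemma ballot_0:
  assumes "0 \<le> h"
  shows "ballot 0 h = (if h = 0 then 1 else 0)"
  using assms by (auto simp: ballot_def choose_int_def elim!: evenE)

text \<open>The index \<open>m\<close> is the number of steps that are not flat.\<close>

lemma num_paths_eq_sum_ballot:
  assumes "0 \<le> h"
  shows "num_paths k h = (\<Sum>m\<le>k. int (k choose m) * ballot m h)"
  using assms
proof (induction k arbitrary: h)
  case 0
  then show ?case by (simp add: num_paths_0 ballot_0)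
next
  case (Suc k)
  have below: "num_paths k (h - 1) = (\<Sum>m\<le>k. int (k choose m) * ballot m (h - 1))"
  proof (cases "h = 0")
    case True
    then show ?thesis by (simp add: num_paths_neg ballot_minus_1)
  next
    case False
    then show ?thesis using Suc by simp
  qed
  have "(\<Sum>m\<le>Suc k. int (Suc k choose m) * ballot m h) =
    ballot 0 h + (\<Sum>m\<le>k. int (Suc k choose Suc m) * ballot (Suc m) h)"
    by (simp only: sum.atMost_Suc_shift) simp
  also have "\<dots> = ballot 0 h + (\<Sum>m\<le>k. int (k choose Suc m) * ballot (Suc m) h) +
    (\<Sum>m\<le>k. int (k choose m) * ballot (Suc m) h)"
    by (simp add: sum.distrib algebra_simps)
  also have "ballot 0 h + (\<Sum>m\<le>k. int (k choose Suc m) * ballot (Suc m) h) =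
    (\<Sum>m\<le>Suc k. int (k choose m) * ballot m h)"
    by (simp only: sum.atMost_Suc_shift) simp
  also have "\<dots> = (\<Sum>m\<le>k. int (k choose m) * ballot m h)"
    by simp
  also have "\<dots> = num_paths k h" using Suc by simp
  also have "(\<Sum>m\<le>k. int (k choose m) * ballot (Suc m) h) = num_paths k (h - 1) + num_paths k (h + 1)"
    unfolding below ballot_Suc using Suc by (simp add: sum.distrib algebra_simps)
  finally show ?case using num_paths_Suc[OF Suc.prems, of k] by simp
qed

lemma ballot_even: "ballot (2 * l) (2 * int r) = f_coeff l (int r)"
proof -
  have "(int (2 * l) - 2 * int r) div 2 = int l - int r" by simp
  then show ?thesis by (simp add: ballot_def f_coeff_def)
qed

lemma f_coeff_eq_0: "int l < r \<Longrightarrow> f_coeff l r = 0"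
  by (simp add: f_coeff_def choose_int_def)

lemma num_ups_closed_paths:
  assumes r: "1 \<le> r"
  shows "num_ups k 0 (int r) = (\<Sum>l = 1..k div 2. int (k choose (2 * l)) * f_coeff l (int r))"
proof -
  have "num_ups k 0 (int r) = num_paths k (2 * int r)"
    using num_ups_eq[OF r, of k 0] by simp
  also have "\<dots> = (\<Sum>m\<le>k. int (k choose m) * ballot m (2 * int r))"
    by (rule num_paths_eq_sum_ballot) simp
  also have "\<dots> = (\<Sum>m\<in>(\<lambda>l. 2 * l) ` {1..k div 2}. int (k choose m) * ballot m (2 * int r))"
  proof (rule sum.mono_neutral_right)
    show "\<forall>m\<in>{..k} - (\<lambda>l. 2 * l) ` {1..k div 2}. int (k choose m) * ballot m (2 * int r) = 0"
    proof
      fix m assume m: "m \<in> {..k} - (\<lambda>l. 2 * l) ` {1..k div 2}"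
      have "ballot m (2 * int r) = 0"
      proof (cases "even m")
        case True
        then obtain l where l: "m = 2 * l" by (elim evenE)
        then have "l = 0" using m by (cases "l = 0") auto
        then show ?thesis using ballot_0[of "2 * int r"] r l by simp
      qed (simp add: ballot_def)
      then show "int (k choose m) * ballot m (2 * int r) = 0" by simp
    qed
  qed auto
  also have "\<dots> = (\<Sum>l = 1..k div 2. int (k choose (2 * l)) * f_coeff l (int r))"
    by (subst sum.reindex) (auto simp: inj_on_def ballot_even)
  finally show ?thesis .
qed

section \<open>The determinant\<close>

lemma card_flats_path_of:
  assumes fin: "finite A" and \<pi>: "\<pi> \<in> nc_matchings A"
  shows "int (card {i \<in> A. path_of \<pi> i = 0}) = 2 * int (card \<pi>) - int (card A)"
proof -
  note part = nc_matchings_partition[OF \<pi>]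
  let ?z = "\<lambda>i. if path_of \<pi> i = 0 then 1 else 0 :: int"
  have "sum ?z V = 2 - int (card V)" if V: "V \<in> \<pi>" for V
    using \<pi> V
  proof (cases rule: nc_matchings_block_cases)
    case (1 a)
    then have "path_of \<pi> a = 0" using path_of_singleton[OF \<pi>] V by simp
    then show ?thesis unfolding 1(1) by simp
  next
    case (2 a b)
    then have "path_of \<pi> a = 1" "path_of \<pi> b = -1" using path_of_arc[OF \<pi>, of a b] V by auto
    then show ?thesis unfolding 2(1) using 2(2) by simp
  qed
  then have "sum ?z A = (\<Sum>V\<in>\<pi>. 2 - int (card V))"
    unfolding sum_over_blocks[OF fin part] by (rule sum.cong[OF refl])
  also have "\<dots> = 2 * int (card \<pi>) - (\<Sum>V\<in>\<pi>. int (card V))"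
    by (simp add: sum_subtractf)
  also have "(\<Sum>V\<in>\<pi>. int (card V)) = int (card A)"
    using sum_over_blocks[OF fin part, of "\<lambda>_. 1 :: int"] by simp
  also have "sum ?z A = int (card {i \<in> A. path_of \<pi> i = 0})"
    using fin by (simp add: sum.If_cases Int_def)
  finally show ?thesis .
qed

lemma ht_up_range:
  assumes s: "s \<in> paths {1..k} h" and up: "s i = 1"
  shows "ht s i \<in> {1..int k}"
proof -
  have "ht s i = sum s ({1..k} \<inter> {..i})"
    unfolding ht_def by (rule sum.mono_neutral_right) (use pathsD(2)[OF s] in auto)
  also have "\<dots> \<le> (\<Sum>j\<in>{1..k} \<inter> {..i}. 1)"
  proof (rule sum_mono)
    fix j show "s j \<le> 1" using pathsD(1)[OF s, of j] by auto
  qed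
  also have "\<dots> \<le> int k"
    using card_mono[of "{1..k}" "{1..k} \<inter> {..i}"] by simp
  finally show ?thesis
    using ht_minus_step_nonneg[of s i] pathsD(3)[OF s] up by simp
qed

context path_weights
begin

lemma path_wt_split:
  assumes "s \<in> paths {1..k} h"
  shows "path_wt {1..k} s = n ^ card {i \<in> {1..k}. s i = 0} *
    (\<Prod>r = 1..k. (mu (int r) / mu (int r - 1)) ^ card {i \<in> {1..k}. s i = 1 \<and> ht s i = int r})"
proof -
  let ?g = "\<lambda>x. mu x / mu (x - 1)"
  have "path_wt {1..k} s =
    (\<Prod>i\<in>{1..k}. (if s i = 0 then n else 1) * (if s i = 1 then ?g (ht s i) else 1))"
    unfolding path_wt_def step_wt_def by (intro prod.cong) auto
  also have "\<dots> = (\<Prod>i | i \<in> {1..k} \<and> s i = 0. n) * (\<Prod>i | i \<in> {1..k} \<and> s i = 1. ?g (ht s i))"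
    by (simp only: prod.distrib prod.inter_filter[OF finite_atLeastAtMost])
  also have "(\<Prod>i | i \<in> {1..k} \<and> s i = 1. ?g (ht s i)) =
    (\<Prod>r = 1..k. \<Prod>i | i \<in> {i. i \<in> {1..k} \<and> s i = 1} \<and> nat (ht s i) = r. ?g (ht s i))"
  proof (rule prod.group[symmetric])
    show "(\<lambda>i. nat (ht s i)) ` {i. i \<in> {1..k} \<and> s i = 1} \<subseteq> {1..k}"
      using ht_up_range[OF assms] by force
  qed auto
  also have "\<dots> = (\<Prod>r = 1..k. ?g (int r) ^ card {i \<in> {1..k}. s i = 1 \<and> ht s i = int r})"
  proof (rule prod.cong)
    fix r assume r: "r \<in> {1..k}"
    have "{i. i \<in> {i. i \<in> {1..k} \<and> s i = 1} \<and> nat (ht s i) = r} =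
      {i \<in> {1..k}. s i = 1 \<and> ht s i = int r}"
      using r by auto
    then have "(\<Prod>i | i \<in> {i. i \<in> {1..k} \<and> s i = 1} \<and> nat (ht s i) = r. ?g (ht s i)) =
      (\<Prod>i\<in>{i \<in> {1..k}. s i = 1 \<and> ht s i = int r}. ?g (ht s i))" by (rule arg_cong)
    also have "\<dots> = (\<Prod>i\<in>{i \<in> {1..k}. s i = 1 \<and> ht s i = int r}. ?g (int r))"
      by (rule prod.cong) auto
    finally show "(\<Prod>i | i \<in> {i. i \<in> {1..k} \<and> s i = 1} \<and> nat (ht s i) = r. ?g (ht s i)) =
      ?g (int r) ^ card {i \<in> {1..k}. s i = 1 \<and> ht s i = int r}" by simp
  qed simp
  finally show ?thesis by simp
qed

text \<open>Summation by parts in the exponents.\<close>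

lemma prod_ratio_telescope:
  "(\<Prod>r = 1..K. (mu (int r) / mu (int r - 1)) powi e r) =
    (\<Prod>r = 1..K. mu (int r) powi (e r - e (Suc r))) * mu (int K) powi e (Suc K)"
proof (induction K)
  case 0
  then show ?case by (simp add: mu_0)
next
  case (Suc K)
  have nz: "mu (int K) \<noteq> 0" "mu (int (Suc K)) \<noteq> 0" using mu_nonzero by auto
  have "(\<Prod>r = 1..Suc K. (mu (int r) / mu (int r - 1)) powi e r) =
    (\<Prod>r = 1..K. mu (int r) powi (e r - e (Suc r))) *
      (mu (int K) powi e (Suc K) * (mu (int (Suc K)) / mu (int K)) powi e (Suc K))"
    using Suc by (simp add: mult_ac)
  also have "mu (int K) powi e (Suc K) * (mu (int (Suc K)) / mu (int K)) powi e (Suc K) =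
    mu (int (Suc K)) powi (e (Suc K) - e (Suc (Suc K)) + e (Suc (Suc K)))"
    using nz by (simp add: power_int_divide_distrib)
  also have "\<dots> = mu (int (Suc K)) powi (e (Suc K) - e (Suc (Suc K))) * mu (int (Suc K)) powi e (Suc (Suc K))"
    using nz by (intro power_int_add) auto
  finally show ?case by (simp add: mult_ac)
qed

text \<open>The product over \<open>r\<close> first runs up to \<open>k\<close>, an evident bound for the height, and is cut down to
  \<open>k div 2\<close> afterwards, since \<open>d_coeff l r\<close> vanishes for \<open>r > l\<close>.\<close>

lemma prod_path_wt:
  "(\<Prod>s\<in>paths {1..k} 0. path_wt {1..k} s) =
    n powi (\<Sum>\<pi>\<in>nc_matchings {1..k}. 2 * int (card \<pi>) - int k) *
    (\<Prod>r = 1..k div 2. mu (int r) powi (\<Sum>l = 1..k div 2. int (k choose (2 * l)) * d_coeff l (int r)))"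
proof -
  define fl where "fl s = card {i \<in> {1..k}. s i = 0}" for s :: "nat \<Rightarrow> int"
  define up where "up s r = card {i \<in> {1..k}. s i = 1 \<and> ht s i = int r}" for s :: "nat \<Rightarrow> int" and r
  define e where "e r = (\<Sum>l = 1..k div 2. int (k choose (2 * l)) * f_coeff l (int r))" for r
  define d where "d r = (\<Sum>l = 1..k div 2. int (k choose (2 * l)) * d_coeff l (int r))" for r
  let ?P = "paths {1..k} 0"
  have "(\<Prod>s\<in>?P. path_wt {1..k} s) =
    (\<Prod>s\<in>?P. n ^ fl s * (\<Prod>r = 1..k. (mu (int r) / mu (int r - 1)) ^ up s r))"
    unfolding fl_def up_def by (intro prod.cong refl path_wt_split)
  also have "\<dots> = n ^ (\<Sum>s\<in>?P. fl s) * (\<Prod>r = 1..k. (mu (int r) / mu (int r - 1)) ^ (\<Sum>s\<in>?P. up s r))"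
    unfolding prod.distrib power_sum by (subst prod.swap) simp
  also have "n ^ (\<Sum>s\<in>?P. fl s) = n powi (\<Sum>\<pi>\<in>nc_matchings {1..k}. 2 * int (card \<pi>) - int k)"
  proof -
    have "int (\<Sum>s\<in>?P. fl s) = (\<Sum>s\<in>?P. int (fl s))" by simp
    also have "\<dots> = (\<Sum>\<pi>\<in>nc_matchings {1..k}. int (fl (path_of \<pi>)))"
      by (rule sum.reindex_bij_betw[symmetric, OF bij_betw_path_of]) simp
    also have "\<dots> = (\<Sum>\<pi>\<in>nc_matchings {1..k}. 2 * int (card \<pi>) - int k)"
      unfolding fl_def by (intro sum.cong refl) (use card_flats_path_of[of "{1..k}"] in simp)
    finally show ?thesis by (metis power_int_of_nat)
  qed
  also have "(\<Prod>r = 1..k. (mu (int r) / mu (int r - 1)) ^ (\<Sum>s\<in>?P. up s r)) =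
    (\<Prod>r = 1..k. (mu (int r) / mu (int r - 1)) powi e r)"
  proof (rule prod.cong)
    fix r assume "r \<in> {1..k}"
    then have "int (\<Sum>s\<in>?P. up s r) = e r"
      using num_ups_closed_paths[of r k] by (simp add: num_ups_def up_def e_def)
    then show "(mu (int r) / mu (int r - 1)) ^ (\<Sum>s\<in>?P. up s r) = (mu (int r) / mu (int r - 1)) powi e r"
      by (metis power_int_of_nat)
  qed simp
  also have "\<dots> = (\<Prod>r = 1..k. mu (int r) powi (e r - e (Suc r))) * mu (int k) powi e (Suc k)"
    by (rule prod_ratio_telescope)
  also have "e (Suc k) = 0"
    unfolding e_def by (intro sum.neutral) (auto simp: f_coeff_eq_0)
  also have "(\<Prod>r = 1..k. mu (int r) powi (e r - e (Suc r))) = (\<Prod>r = 1..k. mu (int r) powi d r)"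
    by (intro prod.cong)
       (auto simp: e_def d_def d_coeff_def sum_subtractf[symmetric] algebra_simps)
  also have "\<dots> = (\<Prod>r = 1..k div 2. mu (int r) powi d r)"
  proof (rule prod.mono_neutral_right)
    show "\<forall>r\<in>{1..k} - {1..k div 2}. mu (int r) powi d r = 1"
    proof
      fix r assume "r \<in> {1..k} - {1..k div 2}"
      then have "d r = 0"
        unfolding d_def d_coeff_def by (intro sum.neutral) (auto simp: f_coeff_eq_0)
      then show "mu (int r) powi d r = 1" by simp
    qed
  qed auto
  finally show ?thesis unfolding d_def by simp
qed

end

lemma poly_chebyshev_indet:
  "poly (chebyshev r) (indet - 1) = to_fract (poly (chebyshev r) [:-1, 1 :: rat:])"
proof -
  have x: "indet - 1 = to_fract [:-1, 1 :: rat:]"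
    by (simp add: indet_def to_fract_def One_fract_def one_pCons)
  show ?thesis
    by (induction r rule: chebyshev.induct) (simp_all add: x to_fract_diff to_fract_mult del: mult_pCons_left mult_pCons_right)
qed

text \<open>Evaluate at \<open>n = 3\<close>, where \<open>P\<^sub>r(2) = r + 1\<close>.\<close>

lemma poly_chebyshev_indet_nonzero: "poly (chebyshev r) (indet - 1) \<noteq> 0"
proof -
  have "poly (poly (chebyshev r) [:-1, 1 :: rat:]) 3 = of_nat (Suc r)"
    by (induction r rule: chebyshev.induct) (auto simp: algebra_simps)
  also have "\<dots> \<noteq> 0" by (simp only: of_nat_eq_0_iff)
  finally have "poly (chebyshev r) [:-1, 1 :: rat:] \<noteq> 0" by auto
  then show ?thesis unfolding poly_chebyshev_indet by simp
qed

lemma path_weights_chebyshev: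
  "path_weights indet (\<lambda>h. if h < 0 then 0 else poly (chebyshev (nat h)) (indet - 1))"
proof
  show "indet \<noteq> 0" by (simp add: indet_def Zero_fract_def eq_fract)
  fix h :: int assume h: "0 \<le> h"
  show "(if h < 0 then 0 else poly (chebyshev (nat h)) (indet - 1)) \<noteq> 0"
    using h poly_chebyshev_indet_nonzero by simp
  show "(if h + 1 < 0 then 0 else poly (chebyshev (nat (h + 1))) (indet - 1)) +
    (if h - 1 < 0 then 0 else poly (chebyshev (nat (h - 1))) (indet - 1)) =
    (indet - 1) * (if h < 0 then 0 else poly (chebyshev (nat h)) (indet - 1))"
  proof (cases "h = 0")
    case False
    define m where "m = nat (h - 1)"
    have "nat h = Suc m" "nat (h + 1) = Suc (Suc m)" "nat (h - 1) = m" using h False by (auto simp: m_def)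
    then show ?thesis using h False by simp
  qed simp
qed simp_all

theorem theorem5p2:
  fixes k :: nat and ps :: "nat set set list"
  assumes "distinct ps" and "set ps = nc_partitions12 k"
  shows "det (gram_matrix k ps) =
    indet powi gram_exponent k *
    (\<Prod>r = 1..k div 2.
       poly (chebyshev r) (indet - 1) powi
         (\<Sum>l = 1..k div 2. int (k choose (2 * l)) * d_coeff l (int r)))"
proof -
  interpret path_weights indet "\<lambda>h. if h < 0 then 0 else poly (chebyshev (nat h)) (indet - 1)"
    by (rule path_weights_chebyshev)
  have nc: "nc_partitions12 k = nc_matchings {1..k}"
    by (simp add: nc_partitions12_def nc_matchings_def)
  show ?thesis
    unfolding gram_matrix_def gram_exponent_def
    using det_join_gram[of "{1..k}" ps] prod_path_wt[of k] assms by (simp add: nc)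
qed

end
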